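(* Let $q$ be a prime power, $s\ge2$, let the bases $\mathfrak{B}_{m,i}$ be as in the context, and let $\boldsymbol{\beta}=(\beta_m)_{m\ge1}$ be a sequence of positive reals with $\sum_{m\ge1}\beta_m<\infty$. Then there exist an integer $L=L(s,q,\boldsymbol{\beta})$ and an $\boldsymbol{\alpha}\in\widetilde{Y}^s$ such that the hyperplane sequence $\mathcal{S}_{\boldsymbol{\alpha}}$ associated with $\boldsymbol{\alpha}$ is a digital $(\mathbf{T},s)$-sequence over $\mathbb{F}_q$ with $$\mathbf{T}(m)\le\log_q\frac{m^{s-1}}{\beta_m}+L\quad\text{for all } m\ge1.$$
   Context: $\mathbb{F}_q$ is the finite field with $q$ elements; $\varphi:\{0,\ldots,q-1\}\to\mathbb{F}_q$ is a fixed bijection with $\varphi(0)=0$. For $m\in\mathbb{N}$, $R_m=\mathbb{F}_q[x]/(x^m)$ (elements identified with polynomials of degree $<m$). For each $i=1,\ldots,s$ and $m\in\mathbb{N}$ an ordered basis $\mathfrak{B}_{m,i}=\{\mathfrak{b}_{m,i,1},\ldots,\mathfrak{b}_{m,i,m}\}$ of $R_m$ over $\mathbb{F}_q$ is fixed such that for $1\le j\le m$ the coefficient vector of $\mathfrak{b}_{m+1,i,j}$ w.r.t. $\{1,\ldots,x^m\}$ equals that of $\mathfrak{b}_{m,i,j}$ w.r.t. $\{1,\ldots,x^{m-1}\}$ with a $0$ appended. $\theta_m:R_m^s\to\mathbb{F}_q^{sm}$ sends $(k_1,\ldots,k_s)$ to the concatenation of the coordinate vectors of $k_i$ w.r.t.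 $\mathfrak{B}_{m,i}$. $Y=\{\alpha\in\mathbb{F}_q[[x]]:\gcd(\alpha\bmod x^m,x^m)=1\ \forall m\}$ and $\widetilde{Y}^s=\{(\alpha_1,\ldots,\alpha_s)\in Y^s:\alpha_1=1\}$; for $\boldsymbol{\alpha}\in Y^s$, $\boldsymbol{\alpha}^{(m)}$ is the coordinatewise reduction mod $x^m$. $\mathcal{N}'_{\boldsymbol{\alpha}^{(m)}}=\{\mathbf{k}\in R_m^s:\sum_i\alpha^{(m)}_ik_i\equiv0\pmod{x^m}\}$, $\mathcal{N}_{\boldsymbol{\alpha}^{(m)}}=\theta_m(\mathcal{N}'_{\boldsymbol{\alpha}^{(m)}})$. Digital sequences: given $C_1,\ldots,C_s\in\mathbb{F}_q^{\mathbb{N}\times\mathbb{N}}$, for $k=\sum_{j\ge0}\kappa_jq^j\in\mathbb{N}_0$ put $\vec k=(\varphi(\kappa_0),\varphi(\kappa_1),\ldots)^\top$, $C_i\vec k=(y_{i,1}(k),y_{i,2}(k),\ldots)^\top$, $x_{k,i}=\sum_{j\ge1}\varphi^{-1}(y_{i,j}(k))q^{-j}$, $\boldsymbol{x}_k=(x_{k,1},\ldots,x_{k,s})$. Let $C_i^{(m)}$ be the upper-left $m\times m$ submatrix of $C_i$ and $C^{(m)}=(C_1^{(m)\top}\cdots C_s^{(m)\top})$. A hyperplane sequence associated with $\boldsymbol{\alpha}$ is a digital sequence whose generating matrices satisfy, for every $m$, that the row space of $C^{(m)}$ equals the orthogonal complement of $\mathcal{N}_{\boldsymbol{\alpha}^{(m)}}$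 in $\mathbb{F}_q^{sm}$ (standard inner product). A set of $q^m$ points in $[0,1)^s$ is a $(t,m,s)$-net in base $q$ if every box $\prod_{i=1}^s[a_iq^{-d_i},(a_i+1)q^{-d_i})$ with integers $d_i\ge0$, $0\le a_i<q^{d_i}$, of volume $q^{t-m}$ contains exactly $q^t$ points. For $x=\sum_{i\ge1}x_iq^{-i}$ (digit expansion from the construction) let $[x]_{q,m}=\sum_{i=1}^mx_iq^{-i}$, componentwise on vectors. For $\mathbf{T}:\mathbb{N}_0\to\mathbb{N}_0$ with $\mathbf{T}(m)\le m$, a sequence is a $(\mathbf{T},s)$-sequence in base $q$ if for all $m,k\in\mathbb{N}_0$ the points $[\boldsymbol{x}_{kq^m}]_{q,m},\ldots,[\boldsymbol{x}_{(k+1)q^m-1}]_{q,m}$ form a $(\mathbf{T}(m),m,s)$-net in base $q$. *)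

theory Defs
  imports
    "Jordan_Normal_Form.VS_Connect"
    "HOL-Computational_Algebra.Formal_Power_Series"
    "HOL-Number_Theory.Cong"
    "HOL-Library.Cardinality"
begin

text \<open>
  The finite field \<open>\<bbbF>\<^sub>q\<close> is a type \<open>'a :: {field, finite}\<close> and \<open>q = CARD('a)\<close>. All indices that
  conventionally start at 1 (coordinates \<open>i\<close>, basis elements \<open>j\<close>, rows and columns of generating
  matrices, digits after the point) start at 0 here; \<open>s\<close>-tuples are functions on \<open>nat\<close> of which
  only the values at \<open>i < s\<close> matter. The parameter \<open>m\<close> is not shifted.
\<close>

global_interpretation poly_vs: Vector_Spaces.vector_space
  "Polynomial.smult :: 'a::field \<Rightarrow> 'a poly \<Rightarrow> 'a poly"
  by unfold_locales (simp_all add: smult_add_right smult_add_left)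


section \<open>Truncated polynomial rings and their bases\<close>

definition R :: "nat \<Rightarrow> 'a::field poly set" where
  "R m = {p. degree p < m}"  \<comment> \<open>representatives of \<open>\<bbbF>\<^sub>q[x]/(x\<^sup>m)\<close>; only used for \<open>m \<ge> 1\<close>\<close>

definition ordered_basis :: "nat \<Rightarrow> (nat \<Rightarrow> 'a::field poly) \<Rightarrow> bool" where
  "ordered_basis m b \<longleftrightarrow>
     inj_on b {..<m} \<and> poly_vs.independent (b ` {..<m}) \<and> poly_vs.span (b ` {..<m}) = R m"

definition compatible_bases :: "nat \<Rightarrow> (nat \<Rightarrow> nat \<Rightarrow> nat \<Rightarrow> 'a::field poly) \<Rightarrow> bool" where
  "compatible_bases s \<bb> \<longleftrightarrow>
     (\<forall>i<s. \<forall>m\<ge>1. ordered_basis m (\<bb> m i)) \<and>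
     (\<forall>i<s. \<forall>m\<ge>1. \<forall>j<m.
        (\<forall>n<m. coeff (\<bb> (Suc m) i j) n = coeff (\<bb> m i j) n) \<and> coeff (\<bb> (Suc m) i j) m = 0)"

text \<open>Position \<open>l\<close> of a vector of length \<open>s m\<close> belongs to block \<open>l div m\<close>, offset \<open>l mod m\<close>.\<close>

definition \<theta> ::
  "nat \<Rightarrow> (nat \<Rightarrow> nat \<Rightarrow> nat \<Rightarrow> 'a::field poly) \<Rightarrow> nat \<Rightarrow> (nat \<Rightarrow> 'a poly) \<Rightarrow> 'a vec" where
  "\<theta> s \<bb> m k = vec (s * m) (\<lambda>l. let i = l div m; j = l mod m in
     poly_vs.representation (\<bb> m i ` {..<m}) (k i) (\<bb> m i j))"


section \<open>Hyperplane sequences\<close>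

definition fps_reduce :: "nat \<Rightarrow> 'a::field fps \<Rightarrow> 'a poly" where
  "fps_reduce m \<alpha> = Poly (map (fps_nth \<alpha>) [0..<m])"

definition Y :: "'a::field fps set" where
  "Y = {\<alpha>. \<forall>m\<ge>1. coprime (fps_reduce m \<alpha>) (monom 1 m)}"

definition Y_tilde :: "nat \<Rightarrow> (nat \<Rightarrow> 'a::field fps) set" where
  "Y_tilde s = {\<alpha>. (\<forall>i<s. \<alpha> i \<in> Y) \<and> \<alpha> 0 = 1}"

definition N' :: "nat \<Rightarrow> nat \<Rightarrow> (nat \<Rightarrow> 'a::field fps) \<Rightarrow> (nat \<Rightarrow> 'a poly) set" where
  "N' s m \<alpha> = {k. (\<forall>i<s. k i \<in> R m) \<and>
     [(\<Sum>i<s. fps_reduce m (\<alpha> i) * k i) = 0] (mod (monom 1 m))}"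

definition N ::
  "nat \<Rightarrow> (nat \<Rightarrow> nat \<Rightarrow> nat \<Rightarrow> 'a::field poly) \<Rightarrow> nat \<Rightarrow> (nat \<Rightarrow> 'a fps) \<Rightarrow> 'a vec set" where
  "N s \<bb> m \<alpha> = \<theta> s \<bb> m ` N' s m \<alpha>"

text \<open>\<open>C i j r\<close> is the entry of the generating matrix \<open>C\<^sub>i\<close> in row \<open>j\<close> and column \<open>r\<close>;
  \<open>juxtaposed\<close> is \<open>(C\<^sub>1\<^sup>T \<dots> C\<^sub>s\<^sup>T)\<close> built from the upper-left \<open>m \<times> m\<close> submatrices.\<close>

definition juxtaposed :: "nat \<Rightarrow> (nat \<Rightarrow> nat \<Rightarrow> nat \<Rightarrow> 'a) \<Rightarrow> nat \<Rightarrow> 'a mat" where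
  "juxtaposed s C m = mat m (s * m) (\<lambda>(r, l). C (l div m) (l mod m) r)"

definition hyperplane_matrices ::
  "nat \<Rightarrow> (nat \<Rightarrow> nat \<Rightarrow> nat \<Rightarrow> 'a::field poly) \<Rightarrow> (nat \<Rightarrow> 'a fps) \<Rightarrow>
     (nat \<Rightarrow> nat \<Rightarrow> nat \<Rightarrow> 'a) \<Rightarrow> bool" where
  "hyperplane_matrices s \<bb> \<alpha> C \<longleftrightarrow>
     (\<forall>m\<ge>1. vec_space.row_space (s * m) (juxtaposed s C m) =
             vec_module.orthogonal_complement (s * m) (N s \<bb> m \<alpha>))"


section \<open>Digital sequences\<close>

definition digit_bijection :: "(nat \<Rightarrow> 'a::{field,finite}) \<Rightarrow> bool" where
  "digit_bijection \<phi> \<longleftrightarrow> bij_betw \<phi> {..<CARD('a)} UNIV \<and> \<phi> 0 = 0"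

definition nat_digit :: "nat \<Rightarrow> nat \<Rightarrow> nat \<Rightarrow> nat" where
  "nat_digit q k r = (k div q ^ r) mod q"

text \<open>The entry \<open>y\<^bsub>i,j\<^esub>(k)\<close> of the product of \<open>C\<^sub>i\<close> with the digit vector of \<open>k\<close>. Since \<open>\<phi> 0 = 0\<close>, only the
  finitely many nonzero digits of \<open>k\<close> contribute.\<close>

definition digital_product ::
  "(nat \<Rightarrow> 'a::{field,finite}) \<Rightarrow> (nat \<Rightarrow> nat \<Rightarrow> nat \<Rightarrow> 'a) \<Rightarrow> nat \<Rightarrow> nat \<Rightarrow> nat \<Rightarrow> 'a" where
  "digital_product \<phi> C k i j =
     (\<Sum>r | nat_digit CARD('a) k r \<noteq> 0. C i j r * \<phi> (nat_digit CARD('a) k r))"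

definition digital_digit ::
  "(nat \<Rightarrow> 'a::{field,finite}) \<Rightarrow> (nat \<Rightarrow> nat \<Rightarrow> nat \<Rightarrow> 'a) \<Rightarrow> nat \<Rightarrow> nat \<Rightarrow> nat \<Rightarrow> nat" where
  "digital_digit \<phi> C k i j = inv_into {..<CARD('a)} \<phi> (digital_product \<phi> C k i j)"

definition digital_sequence ::
  "(nat \<Rightarrow> 'a::{field,finite}) \<Rightarrow> (nat \<Rightarrow> nat \<Rightarrow> nat \<Rightarrow> 'a) \<Rightarrow> nat \<Rightarrow> nat \<Rightarrow> real" where
  "digital_sequence \<phi> C k i = (\<Sum>j. real (digital_digit \<phi> C k i j) / real CARD('a) ^ Suc j)"


section \<open>Nets and \<open>(T,s)\<close>-sequences\<close>

text \<open>Points are counted with multiplicity, hence the point set is a family \<open>(x n)\<^bsub>n \<in> K\<^esub>\<close>.\<close>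

definition is_net ::
  "nat \<Rightarrow> nat \<Rightarrow> nat \<Rightarrow> nat \<Rightarrow> nat set \<Rightarrow> (nat \<Rightarrow> nat \<Rightarrow> real) \<Rightarrow> bool" where
  "is_net q t m s K x \<longleftrightarrow>
     finite K \<and> card K = q ^ m \<and> (\<forall>n\<in>K. \<forall>i<s. x n i \<in> {0..<1}) \<and>
     (\<forall>d a :: nat \<Rightarrow> nat.
        (\<forall>i<s. a i < q ^ d i) \<and>
        (\<Prod>i<s. 1 / real q ^ d i) = real q powi (int t - int m) \<longrightarrow>
        card {n\<in>K. \<forall>i<s. x n i \<in> {real (a i) / real q ^ d i ..< (real (a i) + 1) / real q ^ d i}}
          = q ^ t)"

definition truncation :: "nat \<Rightarrow> nat \<Rightarrow> (nat \<Rightarrow> nat) \<Rightarrow> real" where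
  "truncation q m y = (\<Sum>j<m. real (y j) / real q ^ Suc j)"

text \<open>The truncation \<open>[x]\<^bsub>q,m\<^esub>\<close> refers to a prescribed digit expansion of \<open>x\<close> (which may end in
  infinitely many digits \<open>q - 1\<close>), so a sequence \<open>x\<close> comes with the digits \<open>y\<close> of its points.\<close>

definition is_TS_sequence ::
  "nat \<Rightarrow> (nat \<Rightarrow> nat) \<Rightarrow> nat \<Rightarrow> (nat \<Rightarrow> nat \<Rightarrow> real) \<Rightarrow> (nat \<Rightarrow> nat \<Rightarrow> nat \<Rightarrow> nat) \<Rightarrow> bool" where
  "is_TS_sequence q T s x y \<longleftrightarrow>
     (\<forall>k. \<forall>i<s. (\<forall>j. y k i j < q) \<and> (\<lambda>j. real (y k i j) / real q ^ Suc j) sums x k i) \<and>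
     (\<forall>m. T m \<le> m) \<and>
     (\<forall>m k. is_net q (T m) m s {k * q ^ m ..< (k + 1) * q ^ m} (\<lambda>n i. truncation q m (y n i)))"

end

theory Submission
  imports Defs "HOL-Computational_Algebra.Polynomial_FPS" "HOL-Library.FuncSet"
begin

text \<open>
  By linear algebra, the first \<open>q\<^sup>m\<close> points of the hyperplane sequence form a \<open>(t,m,s)\<close>-net as soon as no
  nonzero \<open>k\<close> with \<open>deg k\<^sub>i < d\<^sub>i\<close> and \<open>\<Sum> d\<^sub>i = m - t\<close> satisfies \<open>\<Sum> \<alpha>\<^sub>i k\<^sub>i \<equiv> 0 (mod x\<^sup>m)\<close>. If \<open>x\<^sup>e\<close> is the
  exact power of \<open>x\<close> dividing such a \<open>k\<close>, then at least two components of \<open>k\<close> are nonzero, so there are at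
  most \<open>q\<^bsup>m - t - 2e\<^esup>\<close> candidates for given \<open>d\<close>, and each is annihilated by a fraction of at most
  \<open>2 q\<^bsup>e - m\<^esup>\<close> of the tuples \<open>\<alpha>\<close>. Summing over \<open>e\<close> and over at most \<open>(m - t + 1)\<^bsup>s - 1\<^esup>\<close> choices of \<open>d\<close>,
  a fraction \<open>O(m\<^bsup>s - 1\<^esup> q\<^bsup>-t\<^esup>)\<close> of the tuples is excluded at level \<open>m\<close>. With \<open>t\<close> as in the theorem this is
  \<open>O(q\<^bsup>-L\<^esup> \<beta>\<^sub>m)\<close>, whose sum over \<open>m\<close> is less than 1 for large \<open>L\<close>; the surviving truncated tuples have an
  infinite branch by compactness.
\<close>

section \<open>Counting tuples with a short relation\<close>

text \<open>The box holds the polynomials of degree below \<open>b\<close> divisible by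
  \<open>x ^ a\<close>. They are kept as power series so that products with the
  \<open>\<alpha> i\<close> stay in one ring and zero needs no degree convention; for
  \<open>b \<le> a\<close> only zero is left.\<close>

definition fps_box :: "nat \<Rightarrow> nat \<Rightarrow> 'a::zero fps set" where
  "fps_box a b = {f. \<forall>n. fps_nth f n \<noteq> 0 \<longrightarrow> a \<le> n \<and> n < b}"

lemma fps_box_nth_eq_0:
  assumes "f \<in> fps_box a b" and "n < a \<or> b \<le> n"
  shows "fps_nth f n = 0"
proof (rule ccontr)
  assume "fps_nth f n \<noteq> 0"
  then have "a \<le> n \<and> n < b" using assms(1) by (simp add: fps_box_def)
  then show False using assms(2) by auto
qed

lemma bij_betw_fps_box:
  "bij_betw (\<lambda>f. restrict (fps_nth f) {a..<b}) (fps_box a b) ({a..<b} \<rightarrow>\<^sub>E (UNIV :: 'a::zero set))"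
proof (rule bij_betw_byWitness[where f' = "\<lambda>g. Abs_fps (\<lambda>n. if n \<in> {a..<b} then g n else 0)"])
  show "\<forall>f\<in>fps_box a b. Abs_fps (\<lambda>n. if n \<in> {a..<b} then restrict (fps_nth f) {a..<b} n else 0) = f"
    by (auto simp: fps_box_def fps_eq_iff)
  show "\<forall>g\<in>{a..<b} \<rightarrow>\<^sub>E (UNIV :: 'a set).
      restrict (fps_nth (Abs_fps (\<lambda>n. if n \<in> {a..<b} then g n else 0))) {a..<b} = g"
    by (auto simp: fun_eq_iff restrict_def PiE_def extensional_def)
qed (auto simp: fps_box_def split: if_splits)

lemma
  shows finite_fps_box: "finite (fps_box a b :: 'a::{zero,finite} fps set)"
    and card_fps_box: "card (fps_box a b :: 'a::{zero,finite} fps set) = CARD('a) ^ (b - a)"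
proof -
  note bij = bij_betw_fps_box[of a b, where 'a = 'a]
  show "finite (fps_box a b :: 'a fps set)"
    using bij_betw_finite[OF bij] by (simp add: finite_PiE)
  show "card (fps_box a b :: 'a fps set) = CARD('a) ^ (b - a)"
    using bij_betw_same_card[OF bij] by (simp add: card_PiE)
qed

lemma card_field_ge_2: "CARD('a::{field,finite}) \<ge> 2"
proof -
  have "card {0, 1 :: 'a} \<le> CARD('a)" by (rule card_mono) auto
  then show ?thesis by simp
qed

text \<open>Over a field and for \<open>n \<ge> 1\<close>, these represent the units modulo
  \<open>x ^ n\<close>, hence the truncations of the elements of \<open>Y\<close>.\<close>

definition unit_fps_box :: "nat \<Rightarrow> 'a::zero fps set" where
  "unit_fps_box n = {f \<in> fps_box 0 n. fps_nth f 0 \<noteq> 0}"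

lemma finite_unit_fps_box: "finite (unit_fps_box n :: 'a::{zero,finite} fps set)"
  by (simp add: unit_fps_box_def finite_fps_box)

text \<open>The exact count is \<open>q ^ n - q ^ (n - 1)\<close>, and \<open>q \<ge> 2\<close>. The
  bound later trades a full count for a count of units at the cost of a factor 2.\<close>

lemma card_unit_fps_box_ge:
  assumes "n \<ge> 1"
  shows "CARD('a) ^ n \<le> 2 * card (unit_fps_box n :: 'a::{field,finite} fps set)"
proof -
  have eq: "(unit_fps_box n :: 'a fps set) = fps_box 0 n - fps_box 1 n"
    by (auto simp: unit_fps_box_def fps_box_def Suc_le_eq)
  have sub: "fps_box 1 n \<subseteq> (fps_box 0 n :: 'a fps set)" by (auto simp: fps_box_def)
  have "card (unit_fps_box n :: 'a fps set) = CARD('a) ^ n - CARD('a) ^ (n - 1)"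
    unfolding eq by (subst card_Diff_subset) (use sub in \<open>simp_all add: finite_fps_box card_fps_box\<close>)
  moreover have "2 * CARD('a) ^ (n - 1) \<le> CARD('a) ^ n"
    using assms card_field_ge_2[where 'a='a] by (cases n) auto
  ultimately show ?thesis by simp
qed

text \<open>Truncations of the members of \<open>Y_tilde s\<close>. The extensional product pins
  down the irrelevant values at \<open>i \<ge> s\<close>, so that the tuples can be counted as
  functions.\<close>

definition unit_tuples :: "nat \<Rightarrow> nat \<Rightarrow> (nat \<Rightarrow> 'a::{zero,one} fps) set" where
  "unit_tuples s n = (\<Pi>\<^sub>E i\<in>{..<s}. if i = 0 then {1} else unit_fps_box n)"

lemma finite_unit_tuples: "finite (unit_tuples s n :: (nat \<Rightarrow> 'a::{field,finite} fps) set)"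
  unfolding unit_tuples_def by (rule finite_PiE) (auto simp: finite_unit_fps_box)

lemma card_unit_tuples:
  assumes "s \<ge> 1"
  shows "card (unit_tuples s n :: (nat \<Rightarrow> 'a::{field,finite} fps) set)
           = card (unit_fps_box n :: 'a fps set) ^ (s - 1)"
proof -
  have "card (unit_tuples s n :: (nat \<Rightarrow> 'a fps) set)
      = (\<Prod>i<s. card (if i = 0 then {1} else unit_fps_box n :: 'a fps set))"
    by (simp add: unit_tuples_def card_PiE)
  also have "\<dots> = (\<Prod>i\<in>{1..<s}. card (if i = 0 then {1} else unit_fps_box n :: 'a fps set))"
    using assms by (intro prod.mono_neutral_right) auto
  also have "\<dots> = card (unit_fps_box n :: 'a fps set) ^ (s - 1)"
    by simp
  finally show ?thesis .
qed

definition annihilates :: "nat \<Rightarrow> nat \<Rightarrow> (nat \<Rightarrow> 'a::comm_ring_1 fps) \<Rightarrow> (nat \<Rightarrow> 'a fps) \<Rightarrow> bool" where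
  "annihilates s m \<alpha> k \<longleftrightarrow> (\<forall>n<m. fps_nth (\<Sum>i<s. \<alpha> i * k i) n = 0)"

text \<open>Orders of vanishing add in an integral domain: the product vanishes to order at least
  \<open>m\<close> and \<open>g\<close> exactly to order \<open>e\<close>, so \<open>f\<close>
  vanishes to order at least \<open>m - e\<close>.\<close>

lemma fps_nth_eq_0_of_mult:
  fixes f g :: "'a::idom fps"
  assumes "\<And>n. n < m \<Longrightarrow> fps_nth (f * g) n = 0" and "fps_nth g e \<noteq> 0" and "n + e < m"
    and "\<And>n. n < e \<Longrightarrow> fps_nth g n = 0"
  shows "fps_nth f n = 0"
proof (rule ccontr)
  assume f: "fps_nth f n \<noteq> 0"
  have "f \<noteq> 0" "g \<noteq> 0" using f assms(2) by auto
  have g: "subdegree g = e" using assms(2,4) by (intro subdegreeI) auto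
  have "subdegree f \<le> n" using f by (rule subdegree_leI)
  have "subdegree (f * g) = subdegree f + e" using \<open>f \<noteq> 0\<close> \<open>g \<noteq> 0\<close> g by simp
  moreover have "fps_nth (f * g) (subdegree (f * g)) \<noteq> 0"
    using \<open>f \<noteq> 0\<close> \<open>g \<noteq> 0\<close> by simp
  ultimately show False using assms(1)[of "subdegree (f * g)"] assms(3) \<open>subdegree f \<le> n\<close> by auto
qed

text \<open>Modulo \<open>x\<^bsup>m - e\<^esup>\<close>, the \<open>i\<close>-th component is determined by the relation and the other components.\<close>

lemma card_annihilated_unit_tuples:
  fixes k :: "nat \<Rightarrow> 'a::{field,finite} fps"
  assumes i: "1 \<le> i" "i < s" and e: "e < m" "fps_nth (k i) e \<noteq> 0"
    and low: "\<And>j. j < e \<Longrightarrow> fps_nth (k i) j = 0"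
  shows "card {\<alpha> \<in> unit_tuples s n. annihilates s m \<alpha> k}
           \<le> card (unit_fps_box n :: 'a fps set) ^ (s - 2) * CARD('a) ^ (n - (m - e))"
proof -
  let ?I = "{..<s} - {i}" and ?J = "{m - e..<n}"
  let ?S = "{\<alpha> \<in> unit_tuples s n. annihilates s m \<alpha> k}"
  let ?W = "\<lambda>i. if i = 0 then {1} else unit_fps_box n :: 'a fps set"
  \<comment> \<open>A tuple is recorded by its components other than \<open>i\<close> and by the
    coefficients of component \<open>i\<close> from index \<open>m - e\<close> on; the relation
    recovers the lower ones.\<close>
  let ?g = "\<lambda>\<alpha>. (restrict \<alpha> ?I, restrict (fps_nth (\<alpha> i)) ?J)"
  let ?T = "(\<Pi>\<^sub>E i\<in>?I. ?W i) \<times> (?J \<rightarrow>\<^sub>E (UNIV :: 'a set))"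
  have inj: "inj_on ?g ?S"
  proof (rule inj_onI)
    fix \<alpha> \<alpha>' assume a: "\<alpha> \<in> ?S" and a': "\<alpha>' \<in> ?S" and eq: "?g \<alpha> = ?g \<alpha>'"
    have off: "\<alpha> j = \<alpha>' j" if "j \<in> ?I" for j
      using eq that by (metis (no_types, lifting) prod.inject restrict_apply')
    have high: "fps_nth (\<alpha> i) j = fps_nth (\<alpha>' i) j" if "j \<in> ?J" for j
      using eq that by (metis (no_types, lifting) prod.inject restrict_apply')
    have "\<alpha> i \<in> unit_fps_box n" "\<alpha>' i \<in> unit_fps_box n"
      using a a' i by (auto simp: unit_tuples_def PiE_iff split: if_splits)
    then have out: "fps_nth (\<alpha> i) j = fps_nth (\<alpha>' i) j" if "j \<ge> n" for j
      using that fps_box_nth_eq_0[of "\<alpha> i" 0 n j] fps_box_nth_eq_0[of "\<alpha>' i" 0 n j]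
      unfolding unit_fps_box_def by simp
    \<comment> \<open>The two tuples can differ only in component \<open>i\<close>, so subtracting
      their relations isolates one product, to which the order argument applies.\<close>
    have "(\<Sum>j<s. \<alpha> j * k j) - (\<Sum>j<s. \<alpha>' j * k j) = (\<Sum>j<s. (\<alpha> j - \<alpha>' j) * k j)"
      by (simp add: sum_subtractf left_diff_distrib)
    also have "\<dots> = (\<alpha> i - \<alpha>' i) * k i"
      using i off by (subst sum.remove[of _ i]) auto
    finally have diff: "(\<Sum>j<s. \<alpha> j * k j) - (\<Sum>j<s. \<alpha>' j * k j) = (\<alpha> i - \<alpha>' i) * k i" .
    have "fps_nth ((\<alpha> i - \<alpha>' i) * k i) j = 0" if "j < m" for j
      using a a' that unfolding diff[symmetric] annihilates_def by simp
    then have low_eq: "fps_nth (\<alpha> i - \<alpha>' i) j = 0" if "j < m - e" for j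
      by (rule fps_nth_eq_0_of_mult[of m _ "k i" e]) (use e low that in auto)
    have "fps_nth (\<alpha> i) j = fps_nth (\<alpha>' i) j" for j
      using high[of j] out[of j] low_eq[of j] by (cases "j < m - e"; cases "j < n") auto
    then have "\<alpha> i = \<alpha>' i" by (simp add: fps_eq_iff)
    with off have "\<alpha> j = \<alpha>' j" if "j < s" for j using that by (cases "j = i") auto
    then show "\<alpha> = \<alpha>'" using a a' by (auto simp: unit_tuples_def intro: PiE_ext)
  qed
  have img: "?g ` ?S \<subseteq> ?T"
  proof (rule image_subsetI)
    fix \<alpha> assume "\<alpha> \<in> ?S"
    then have "\<alpha> j \<in> ?W j" if "j < s" for j
      using that by (auto simp only: unit_tuples_def PiE_iff mem_Collect_eq lessThan_iff)
    then have "restrict \<alpha> ?I \<in> (\<Pi>\<^sub>E i\<in>?I. ?W i)" by (intro restrict_PiE_iff[THEN iffD2]) auto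
    then show "?g \<alpha> \<in> ?T" by auto
  qed
  have fin: "finite (\<Pi>\<^sub>E i\<in>?I. ?W i)" 
    by (intro finite_PiE) (auto simp: finite_unit_fps_box)
  have "card ?S \<le> card ?T"
    using inj img by (rule card_inj_on_le) (auto intro!: finite_cartesian_product fin finite_PiE)
  also have "card ?T = (\<Prod>j\<in>?I. card (?W j)) * CARD('a) ^ (n - (m - e))"
    by (simp add: card_cartesian_product card_PiE)
  \<comment> \<open>Component 0 is fixed to 1 and component \<open>i\<close> has been split off,
    which leaves \<open>s - 2\<close> free unit components.\<close>
  also have "(\<Prod>j\<in>?I. card (?W j)) = (\<Prod>j\<in>{1..<s} - {i}. card (?W j))"
    using i by (intro prod.mono_neutral_right) auto
  also have "\<dots> = (\<Prod>j\<in>{1..<s} - {i}. card (unit_fps_box n :: 'a fps set))"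
    by (rule prod.cong) auto
  also have "\<dots> = card (unit_fps_box n :: 'a fps set) ^ (s - 2)"
    using i by (simp add: card_Diff_singleton numeral_2_eq_2)
  finally show ?thesis .
qed

text \<open>Membership in \<open>fps_box 0 (d i)\<close> bounds the degree of \<open>k i\<close> by
  \<open>degree (k i) < d i\<close>, with \<open>k i = 0\<close> when \<open>d i = 0\<close>. For
  hyperplane matrices, absence of such a relation will yield independence of the first
  \<open>d i\<close> rows of all \<open>C i\<close> together, for every split \<open>d\<close> of
  \<open>M\<close>.\<close>

definition short_relation :: "nat \<Rightarrow> nat \<Rightarrow> nat \<Rightarrow> (nat \<Rightarrow> 'a::comm_ring_1 fps) \<Rightarrow> bool" where
  "short_relation s m M \<alpha> \<longleftrightarrow> (\<exists>d k. (\<Sum>i<s. d i) = M \<and> (\<forall>i<s. k i \<in> fps_box 0 (d i)) \<and>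
     (\<exists>i<s. k i \<noteq> 0) \<and> annihilates s m \<alpha> k)"

text \<open>This supplies the data for the union bound: two components with degree bound above the
  order \<open>e\<close>, which shrink the number of candidates by \<open>q ^ (2 * e)\<close>, and
  an index \<open>l \<ge> 1\<close>, since component 0 of the tuples is fixed and cannot be
  varied.\<close>

lemma short_relation_witness:
  fixes \<alpha> :: "nat \<Rightarrow> 'a::idom fps"
  assumes "short_relation s m M \<alpha>" and "M \<le> m" and unit: "\<And>i. i < s \<Longrightarrow> fps_nth (\<alpha> i) 0 \<noteq> 0"
  obtains d e i j k where
    "d \<in> {..<s} \<rightarrow>\<^sub>E {..M}" "(\<Sum>i<s. d i) = M" "e < m"
    "i < s" "j < s" "i \<noteq> j" "e < d i" "e < d j"
    "k \<in> (\<Pi>\<^sub>E i\<in>{..<s}. fps_box e (d i))"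
    "\<exists>l. 1 \<le> l \<and> l < s \<and> fps_nth (k l) e \<noteq> 0" "annihilates s m \<alpha> k"
proof -
  from assms(1) obtain d k where d: "(\<Sum>i<s. d i) = M" and k: "\<And>i. i < s \<Longrightarrow> k i \<in> fps_box 0 (d i)"
    and nz: "\<exists>i<s. k i \<noteq> 0" and ann: "annihilates s m \<alpha> k"
    unfolding short_relation_def by blast
  \<comment> \<open>At the least order \<open>e\<close>, the relation reads \<open>\<Sum>i. \<alpha>\<^sub>i(0) k\<^sub>i(e) = 0\<close>, so at least two \<open>k\<^sub>i(e)\<close> are nonzero.\<close>
  define e where "e = (LEAST e. \<exists>i<s. fps_nth (k i) e \<noteq> 0)"
  have "\<exists>e. \<exists>i<s. fps_nth (k i) e \<noteq> 0"
    using nz by (metis fps_nonzero_nth)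
  then have "\<exists>i<s. fps_nth (k i) e \<noteq> 0" unfolding e_def by (rule LeastI_ex)
  then obtain i where i: "i < s" "fps_nth (k i) e \<noteq> 0" by blast
  have low: "fps_nth (k l) n = 0" if "l < s" "n < e" for l n
    using not_less_Least[of n "\<lambda>e. \<exists>i<s. fps_nth (k i) e \<noteq> 0"] that unfolding e_def by blast
  have d_le: "d l \<le> M" if "l < s" for l
    using that unfolding d[symmetric] by (intro member_le_sum) auto
  have less_d: "e < d l" if "l < s" "fps_nth (k l) e \<noteq> 0" for l
    using k[of l] that unfolding fps_box_def by auto
  have "e < m" using less_d[OF i] d_le[OF i(1)] \<open>M \<le> m\<close> by simp
  have "0 = fps_nth (\<Sum>l<s. \<alpha> l * k l) e"
    using ann \<open>e < m\<close> by (simp add: annihilates_def)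
  also have "\<dots> = (\<Sum>l<s. fps_nth (\<alpha> l) 0 * fps_nth (k l) e)"
    unfolding fps_sum_nth
  proof (rule sum.cong[OF refl])
    fix l assume "l \<in> {..<s}"
    then have "fps_nth (\<alpha> l * k l) e = (\<Sum>j\<in>{0}. fps_nth (\<alpha> l) j * fps_nth (k l) (e - j))"
      unfolding fps_mult_nth by (intro sum.mono_neutral_right) (auto simp: low)
    then show "fps_nth (\<alpha> l * k l) e = fps_nth (\<alpha> l) 0 * fps_nth (k l) e" by simp
  qed
  finally have sum0: "(\<Sum>l<s. fps_nth (\<alpha> l) 0 * fps_nth (k l) e) = 0" by simp
  have "\<exists>j<s. j \<noteq> i \<and> fps_nth (k j) e \<noteq> 0"
  proof (rule ccontr)
    assume "\<not> ?thesis"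
    then have "(\<Sum>l<s. fps_nth (\<alpha> l) 0 * fps_nth (k l) e) = (\<Sum>l\<in>{i}. fps_nth (\<alpha> l) 0 * fps_nth (k l) e)"
      using i by (intro sum.mono_neutral_right) auto
    with sum0 unit[OF i(1)] i(2) show False by simp
  qed
  then obtain j where j: "j < s" "j \<noteq> i" "fps_nth (k j) e \<noteq> 0" by blast
  show thesis
  proof (rule that[of "restrict d {..<s}" e i j "restrict k {..<s}"])
    show "restrict k {..<s} \<in> (\<Pi>\<^sub>E i\<in>{..<s}. fps_box e (restrict d {..<s} i))"
      using k low unfolding fps_box_def by (auto simp: PiE_iff not_less[symmetric])
    \<comment> \<open>Of the two distinct indices \<open>i\<close> and \<open>j\<close>, at least
      one is not 0.\<close>
    show "\<exists>l. 1 \<le> l \<and> l < s \<and> fps_nth (restrict k {..<s} l) e \<noteq> 0"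
    proof (cases "i = 0")
      case True
      with j show ?thesis by (intro exI[of _ j]) simp
    next
      case False
      with i show ?thesis by (intro exI[of _ i]) simp
    qed
    show "annihilates s m \<alpha> (restrict k {..<s})"
      using ann by (simp add: annihilates_def)
  qed (use d d_le i j less_d \<open>e < m\<close> in \<open>auto simp: PiE_iff\<close>)
qed

text \<open>The entry \<open>d 0\<close> is determined by the other entries and the total, so
  forgetting it is injective.\<close>

lemma card_compositions_le:
  assumes "s \<ge> 1"
  shows "card {d \<in> {..<s} \<rightarrow>\<^sub>E {..M::nat}. (\<Sum>i<s. d i) = M} \<le> (M + 1) ^ (s - 1)"
proof -
  let ?D = "{d \<in> {..<s} \<rightarrow>\<^sub>E {..M}. (\<Sum>i<s. d i) = M}"
  have split: "(\<Sum>i<s. d i) = d 0 + (\<Sum>i\<in>{1..<s}. d i)" for d :: "nat \<Rightarrow> nat"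
    using assms by (simp add: lessThan_atLeast0 sum.atLeast_Suc_lessThan)
  have "inj_on (\<lambda>d. restrict d {1..<s}) ?D"
  proof (rule inj_onI)
    fix d d' assume d: "d \<in> ?D" and d': "d' \<in> ?D"
      and eq: "restrict d {1..<s} = restrict d' {1..<s}"
    have pos: "d i = d' i" if "i \<in> {1..<s}" for i
      using eq that by (metis restrict_apply')
    then have "(\<Sum>i\<in>{1..<s}. d i) = (\<Sum>i\<in>{1..<s}. d' i)" by (intro sum.cong) auto
    then have "d 0 = d' 0" using d d' split[of d] split[of d'] by simp
    then have "d i = d' i" if "i < s" for i using pos[of i] that by (cases "i = 0") auto
    then show "d = d'" using d d' by (auto intro: PiE_ext)
  qed
  moreover have "(\<lambda>d. restrict d {1..<s}) ` ?D \<subseteq> {1..<s} \<rightarrow>\<^sub>E {..M}"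
    by (auto simp: PiE_iff)
  ultimately have "card ?D \<le> card ({1..<s} \<rightarrow>\<^sub>E {..M})"
    by (rule card_inj_on_le) (auto intro: finite_PiE)
  then show ?thesis by (simp add: card_PiE)
qed

text \<open>Truncated subtraction lowers the terms at \<open>i\<close> and \<open>j\<close> by
  exactly \<open>e\<close> and raises none. This is where two large components save
  \<open>2 * e\<close> in the exponent.\<close>

lemma sum_excess_le:
  fixes d :: "nat \<Rightarrow> nat"
  assumes "i < s" "j < s" "i \<noteq> j" "e \<le> d i" "e \<le> d j"
  shows "(\<Sum>l<s. d l - e) + 2 * e \<le> (\<Sum>l<s. d l)"
proof -
  have split: "(\<Sum>l<s. f l) = f i + (f j + (\<Sum>l\<in>{..<s} - {i} - {j}. f l))" for f :: "nat \<Rightarrow> nat"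
    using assms by (simp add: sum.remove[of "{..<s}" i] sum.remove[of "{..<s} - {i}" j])
  have "(\<Sum>l\<in>{..<s} - {i} - {j}. d l - e) \<le> (\<Sum>l\<in>{..<s} - {i} - {j}. d l)"
    by (rule sum_mono) simp
  then show ?thesis using assms unfolding split by linarith
qed

lemma sum_inverse_power_le_2:
  fixes q :: real
  assumes "q \<ge> 2"
  shows "(\<Sum>e<m. 1 / q ^ e) \<le> 2"
proof -
  have "(\<Sum>e<m. 1 / q ^ e) \<le> (\<Sum>e<m. (1 / 2) ^ e)"
    using assms by (intro sum_mono) (auto simp: power_one_over intro!: divide_left_mono power_mono)
  also have "\<dots> = 2 - 2 * (1 / 2) ^ m" by (induction m) (simp_all add: field_simps)
  also have "\<dots> \<le> 2" by simp
  finally show ?thesis .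
qed

text \<open>Union bound over splits \<open>d\<close>, orders \<open>e\<close> and candidates
  \<open>k\<close>. The constant 4 is a factor 2 from the geometric series over \<open>e\<close>
  times a factor 2 from \<open>card_unit_fps_box_ge\<close>. The truncation level \<open>n\<close>
  may exceed \<open>m\<close>, so that several levels can be treated in one space of tuples.\<close>

lemma card_short_relation_unit_tuples_le:
  assumes "s \<ge> 2" "M \<le> m" "m \<le> n" "n \<ge> 1"
  shows "real (card {\<alpha> \<in> unit_tuples s n. short_relation s m M (\<alpha> :: nat \<Rightarrow> 'a::{field,finite} fps)})
    \<le> 4 * real (M + 1) ^ (s - 1) * real CARD('a) ^ M / real CARD('a) ^ m
        * real (card (unit_tuples s n :: (nat \<Rightarrow> 'a fps) set))"
proof -
  let ?q = "CARD('a)" and ?V = "unit_fps_box n :: 'a fps set"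
  define D where "D = {d \<in> {..<s} \<rightarrow>\<^sub>E {..M}. (\<Sum>i<s. d i) = M}"
  define E where "E d = {e. e < m \<and> (\<exists>i<s. \<exists>j<s. i \<noteq> j \<and> e < d i \<and> e < d j)}" for d :: "nat \<Rightarrow> nat"
  define K where "K d e = {k \<in> (\<Pi>\<^sub>E i\<in>{..<s}. fps_box e (d i)).
    \<exists>l. 1 \<le> l \<and> l < s \<and> fps_nth (k l) e \<noteq> (0::'a)}" for d e
  define S where "S k = {\<alpha> \<in> unit_tuples s n. annihilates s m \<alpha> k}" for k :: "nat \<Rightarrow> 'a fps"
  let ?B = "{\<alpha> \<in> unit_tuples s n. short_relation s m M (\<alpha> :: nat \<Rightarrow> 'a fps)}"
  have finD: "finite D" unfolding D_def by (simp add: finite_PiE)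
  have finE: "finite (E d)" for d unfolding E_def by auto
  have finP: "finite (\<Pi>\<^sub>E i\<in>{..<s}. fps_box e (d i) :: 'a fps set)" for d e
    by (intro finite_PiE) (auto simp: finite_fps_box)
  have finK: "finite (K d e)" for d e
    unfolding K_def by (rule finite_subset[OF _ finP]) auto
  have finS: "finite (S k)" for k unfolding S_def by (simp add: finite_unit_tuples)
  have "?B \<subseteq> (\<Union>d\<in>D. \<Union>e\<in>E d. \<Union>k\<in>K d e. S k)"
  proof
    fix \<alpha> assume \<alpha>: "\<alpha> \<in> ?B"
    have "fps_nth (\<alpha> i) 0 \<noteq> 0" if "i < s" for i
    proof -
      have "\<alpha> i \<in> (if i = 0 then {1} else unit_fps_box n)"
        using \<alpha> that by (auto simp only: unit_tuples_def PiE_iff mem_Collect_eq lessThan_iff)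
      then show ?thesis by (cases "i = 0") (auto simp: unit_fps_box_def)
    qed
    moreover have "short_relation s m M \<alpha>" using \<alpha> by simp
    ultimately obtain d e i j k where
      w: "d \<in> {..<s} \<rightarrow>\<^sub>E {..M}" "(\<Sum>i<s. d i) = M" "e < m"
        "i < s" "j < s" "i \<noteq> j" "e < d i" "e < d j"
        "k \<in> (\<Pi>\<^sub>E i\<in>{..<s}. fps_box e (d i))"
        "\<exists>l. 1 \<le> l \<and> l < s \<and> fps_nth (k l) e \<noteq> 0" "annihilates s m \<alpha> k"
      using short_relation_witness[OF _ \<open>M \<le> m\<close>, of s \<alpha>] by blast
    have "d \<in> D" using w unfolding D_def by blast
    moreover have "e \<in> E d" using w unfolding E_def by blast
    moreover have "k \<in> K d e" using w unfolding K_def by blast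
    moreover have "\<alpha> \<in> S k" using w \<alpha> unfolding S_def by blast
    ultimately show "\<alpha> \<in> (\<Union>d\<in>D. \<Union>e\<in>E d. \<Union>k\<in>K d e. S k)" by blast
  qed
  then have "card ?B \<le> card (\<Union>d\<in>D. \<Union>e\<in>E d. \<Union>k\<in>K d e. S k)"
    by (rule card_mono[rotated]) (intro finite_UN_I finD finE finK finS)
  also have "\<dots> \<le> (\<Sum>d\<in>D. card (\<Union>e\<in>E d. \<Union>k\<in>K d e. S k))"
    by (rule card_UN_le[OF finD])
  also have "\<dots> \<le> (\<Sum>d\<in>D. \<Sum>e\<in>E d. card (\<Union>k\<in>K d e. S k))"
    by (intro sum_mono card_UN_le finE)
  also have "\<dots> \<le> (\<Sum>d\<in>D. \<Sum>e\<in>E d. \<Sum>k\<in>K d e. card (S k))"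
    by (intro sum_mono card_UN_le finK)
  finally have "real (card ?B) \<le> (\<Sum>d\<in>D. \<Sum>e\<in>E d. real (\<Sum>k\<in>K d e. card (S k)))"
    by (simp flip: of_nat_sum)
  also have "\<dots> \<le> (\<Sum>d\<in>D. \<Sum>e\<in>E d. real (card ?V) ^ (s - 2) * real ?q ^ (M + n - m) * (1 / real ?q ^ e))"
  proof (intro sum_mono)
    fix d e assume d: "d \<in> D" and e: "e \<in> E d"
    have "(\<Sum>k\<in>K d e. card (S k)) \<le> (\<Sum>k\<in>K d e. card ?V ^ (s - 2) * ?q ^ (n - (m - e)))"
    proof (rule sum_mono)
      fix k assume k: "k \<in> K d e"
      then obtain l where l: "1 \<le> l" "l < s" "fps_nth (k l) e \<noteq> 0" unfolding K_def by blast
      have "k l \<in> fps_box e (d l)" using k l unfolding K_def by (auto simp: PiE_iff)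
      then have "fps_nth (k l) j = 0" if "j < e" for j
        using that by (intro fps_box_nth_eq_0[of "k l" e "d l"]) auto
      then show "card (S k) \<le> card ?V ^ (s - 2) * ?q ^ (n - (m - e))"
        unfolding S_def using l e by (intro card_annihilated_unit_tuples[of l]) (auto simp: E_def)
    qed
    also have "\<dots> = card (K d e) * (card ?V ^ (s - 2) * ?q ^ (n - (m - e)))" by simp
    also have "card (K d e) \<le> card (\<Pi>\<^sub>E i\<in>{..<s}. fps_box e (d i) :: 'a fps set)"
      unfolding K_def by (rule card_mono[OF finP]) auto
    also have "\<dots> = ?q ^ (\<Sum>i<s. d i - e)"
      by (simp add: card_PiE card_fps_box power_sum)
    finally have le: "(\<Sum>k\<in>K d e. card (S k)) \<le> ?q ^ (\<Sum>i<s. d i - e) * (card ?V ^ (s - 2) * ?q ^ (n - (m - e)))"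
      by simp
    obtain i j where ij: "i < s" "j < s" "i \<noteq> j" "e < d i" "e < d j" "e < m"
      using e unfolding E_def by blast
    have "(\<Sum>i<s. d i - e) + 2 * e \<le> M"
      using sum_excess_le[of i s j e d] ij d by (simp add: D_def)
    \<comment> \<open>Exponent balance: the count of \<open>k\<close> saves \<open>2 * e\<close>,
      the weaker constraint on the tuples loses \<open>e\<close>, and the remaining \<open>e\<close>
      makes the sum over orders geometric.\<close>
    then have "(\<Sum>i<s. d i - e) + (n - (m - e)) + e \<le> M + n - m"
      using ij \<open>m \<le> n\<close> by linarith
    then have "?q ^ (\<Sum>i<s. d i - e) * ?q ^ (n - (m - e)) * ?q ^ e \<le> ?q ^ (M + n - m)"
      unfolding power_add[symmetric] by (intro power_increasing) auto
    then have "real (?q ^ (\<Sum>i<s. d i - e) * ?q ^ (n - (m - e)) * ?q ^ e) \<le> real (?q ^ (M + n - m))"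
      by (rule of_nat_mono)
    then have pow: "real ?q ^ (\<Sum>i<s. d i - e) * real ?q ^ (n - (m - e)) \<le> real ?q ^ (M + n - m) * (1 / real ?q ^ e)"
      by (simp add: field_simps)
    have "real (\<Sum>k\<in>K d e. card (S k)) \<le> real (?q ^ (\<Sum>i<s. d i - e) * (card ?V ^ (s - 2) * ?q ^ (n - (m - e))))"
      using le by (rule of_nat_mono)
    also have "\<dots> = real (card ?V) ^ (s - 2) * (real ?q ^ (\<Sum>i<s. d i - e) * real ?q ^ (n - (m - e)))"
      by simp
    also have "\<dots> \<le> real (card ?V) ^ (s - 2) * (real ?q ^ (M + n - m) * (1 / real ?q ^ e))"
      by (rule mult_left_mono[OF pow]) simp
    finally show "real (\<Sum>k\<in>K d e. card (S k)) \<le> real (card ?V) ^ (s - 2) * real ?q ^ (M + n - m) * (1 / real ?q ^ e)"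
      by simp
  qed
  also have "\<dots> \<le> (\<Sum>d\<in>D. real (card ?V) ^ (s - 2) * real ?q ^ (M + n - m) * 2)"
  proof (rule sum_mono)
    fix d
    have "(\<Sum>e\<in>E d. 1 / real ?q ^ e) \<le> (\<Sum>e<m. 1 / real ?q ^ e)"
      by (rule sum_mono2) (auto simp: E_def)
    also have "\<dots> \<le> 2" using card_field_ge_2[where 'a='a] by (intro sum_inverse_power_le_2) simp
    finally show "(\<Sum>e\<in>E d. real (card ?V) ^ (s - 2) * real ?q ^ (M + n - m) * (1 / real ?q ^ e))
        \<le> real (card ?V) ^ (s - 2) * real ?q ^ (M + n - m) * 2"
      unfolding sum_distrib_left[symmetric] by (rule mult_left_mono) simp
  qed
  also have "\<dots> = real (card D) * (real (card ?V) ^ (s - 2) * real ?q ^ (M + n - m) * 2)" by simp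
  also have "\<dots> \<le> real (M + 1) ^ (s - 1) * (real (card ?V) ^ (s - 2) * real ?q ^ (M + n - m) * 2)"
  proof (rule mult_right_mono)
    have "real (card D) \<le> real ((M + 1) ^ (s - 1))"
      using card_compositions_le[of s M] \<open>s \<ge> 2\<close> unfolding D_def by (intro of_nat_mono) simp
    then show "real (card D) \<le> real (M + 1) ^ (s - 1)" by simp
  qed simp
  also have "real ?q ^ (M + n - m) = real ?q ^ M / real ?q ^ m * real ?q ^ n"
  proof -
    have "real ?q ^ (M + n - m) * real ?q ^ m = real ?q ^ M * real ?q ^ n"
      using \<open>m \<le> n\<close> by (simp flip: power_add)
    then show ?thesis by (simp add: field_simps)
  qed
  \<comment> \<open>The single factor \<open>q ^ n\<close> is traded for twice the number of units,
    which restores the cardinality of the full set of unit tuples.\<close>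
  also have "real (M + 1) ^ (s - 1) * (real (card ?V) ^ (s - 2) * (real ?q ^ M / real ?q ^ m * real ?q ^ n) * 2)
      \<le> real (M + 1) ^ (s - 1) * (real (card ?V) ^ (s - 2) * (real ?q ^ M / real ?q ^ m * (2 * real (card ?V))) * 2)"
  proof (intro mult_left_mono mult_right_mono)
    have "real (?q ^ n) \<le> real (2 * card ?V)"
      using card_unit_fps_box_ge[OF \<open>n \<ge> 1\<close>, where 'a='a] by (rule of_nat_mono)
    then show "real ?q ^ n \<le> 2 * real (card ?V)" by simp
  qed simp_all
  also have "\<dots> = 4 * real (M + 1) ^ (s - 1) * real ?q ^ M / real ?q ^ m * (real (card ?V) ^ (s - 2) * real (card ?V))"
    by simp
  also have "real (card ?V) ^ (s - 2) * real (card ?V) = real (card ?V) ^ (s - 1)"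
  proof -
    have "s - 1 = Suc (s - 2)" using \<open>s \<ge> 2\<close> by simp
    then show ?thesis by simp
  qed
  also have "\<dots> = real (card (unit_tuples s n :: (nat \<Rightarrow> 'a fps) set))"
    using \<open>s \<ge> 2\<close> by (simp add: card_unit_tuples)
  finally show ?thesis .
qed

section \<open>Existence of a tuple without short relations\<close>

text \<open>Levels with \<open>M m = 0\<close> exclude no tuple and can be left out of the union
  bound; the later estimate by \<open>\<beta>\<close> covers only the other levels.\<close>

lemma not_short_relation_0: "\<not> short_relation s m 0 \<alpha>"
  by (auto simp: short_relation_def fps_box_def fps_eq_iff)

text \<open>The excluded fractions of all levels up to \<open>n\<close> sum to less than 1, so one
  tuple survives all of them at once.\<close>

lemma exists_good_unit_tuple:
  assumes "s \<ge> 2" "n \<ge> 1" and M: "\<And>m. M m \<le> m"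
    and less: "(\<Sum>m | m \<in> {1..n} \<and> M m > 0.
      4 * real (M m + 1) ^ (s - 1) * real CARD('a) ^ M m / real CARD('a) ^ m) < 1"
  shows "\<exists>\<alpha> \<in> unit_tuples s n. \<forall>m\<in>{1..n}. \<not> short_relation s m (M m) (\<alpha> :: nat \<Rightarrow> 'a::{field,finite} fps)"
proof (rule ccontr)
  assume contra: "\<not> ?thesis"
  let ?U = "unit_tuples s n :: (nat \<Rightarrow> 'a fps) set"
  let ?I = "{m. m \<in> {1..n} \<and> M m > 0}"
  let ?B = "\<lambda>m. {\<alpha> \<in> ?U. short_relation s m (M m) \<alpha>}"
  let ?c = "\<lambda>m. 4 * real (M m + 1) ^ (s - 1) * real CARD('a) ^ M m / real CARD('a) ^ m"
  have "?U \<subseteq> (\<Union>m\<in>?I. ?B m)"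
  proof
    fix \<alpha> assume "\<alpha> \<in> ?U"
    with contra obtain m where "m \<in> {1..n}" "short_relation s m (M m) \<alpha>" by blast
    moreover from this have "M m > 0" using not_short_relation_0 by (cases "M m = 0") auto
    ultimately show "\<alpha> \<in> (\<Union>m\<in>?I. ?B m)" using \<open>\<alpha> \<in> ?U\<close> by blast
  qed
  then have "card ?U \<le> card (\<Union>m\<in>?I. ?B m)"
    by (rule card_mono[rotated]) (auto simp: finite_unit_tuples)
  also have "\<dots> \<le> (\<Sum>m\<in>?I. card (?B m))"
    by (rule card_UN_le) simp
  finally have "real (card ?U) \<le> (\<Sum>m\<in>?I. real (card (?B m)))"
    by (simp flip: of_nat_sum)
  also have "\<dots> \<le> (\<Sum>m\<in>?I. ?c m * real (card ?U))"
    using assms(1,2) M by (intro sum_mono card_short_relation_unit_tuples_le) auto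
  also have "\<dots> = (\<Sum>m\<in>?I. ?c m) * real (card ?U)"
    by (simp add: sum_distrib_right)
  finally have le: "real (card ?U) \<le> (\<Sum>m\<in>?I. ?c m) * real (card ?U)" .
  have "card (unit_fps_box n :: 'a fps set) > 0"
    using card_unit_fps_box_ge[OF \<open>n \<ge> 1\<close>, where 'a='a] by (cases "card (unit_fps_box n :: 'a fps set)") auto
  then have "real (card ?U) > 0"
    using \<open>s \<ge> 2\<close> by (simp add: card_unit_tuples)
  with le less show False by (simp add: mult_le_cancel_right1)
qed

text \<open>Koenig's lemma by repeated pigeonholing: nested infinite sets of indices
  \<open>N\<close> fix one entry of \<open>F N\<close> after the other, and the limit inherits each
  \<open>P m\<close> because \<open>P m\<close> sees only the entries below
  \<open>m\<close>.\<close>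

lemma Koenig_finite_alphabet:
  fixes P :: "nat \<Rightarrow> (nat \<Rightarrow> 'b) \<Rightarrow> bool"
  assumes fin: "finite X"
    and ex: "\<And>N. \<exists>f. (\<forall>n. f n \<in> X) \<and> (\<forall>m\<le>N. P m f)"
    and local: "\<And>m f g. (\<And>n. n < m \<Longrightarrow> f n = g n) \<Longrightarrow> P m f \<Longrightarrow> P m g"
  shows "\<exists>f. \<forall>m. P m f"
proof -
  from ex obtain F where F: "\<And>N n. F N n \<in> X" "\<And>N m. m \<le> N \<Longrightarrow> P m (F N)" by metis
  \<comment> \<open>\<open>S (Suc n)\<close> refines \<open>S n\<close> so that entry
    \<open>n\<close> is constant on it.\<close>
  have "\<exists>S. \<forall>n. infinite (S n) \<and> (S (Suc n) \<subseteq> S n \<and> (\<exists>v. \<forall>N\<in>S (Suc n). F N n = v))"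
  proof (rule dependent_nat_choice)
    show "\<exists>S :: nat set. infinite S" by (rule exI[of _ UNIV]) simp
  next
    fix S :: "nat set" and n assume S: "infinite S"
    have "finite ((\<lambda>N. F N n) ` S)" using F(1) by (auto intro: finite_subset[OF _ fin])
    from pigeonhole_infinite[OF S this] obtain N0 where
      "infinite {N \<in> S. F N n = F N0 n}" by blast
    then show "\<exists>S'. infinite S' \<and> S' \<subseteq> S \<and> (\<exists>v. \<forall>N\<in>S'. F N n = v)"
      by (intro exI[of _ "{N \<in> S. F N n = F N0 n}"]) auto
  qed
  then obtain S where inf: "\<And>n. infinite (S n)" and sub: "\<And>n. S (Suc n) \<subseteq> S n"
    and const: "\<And>n. \<exists>v. \<forall>N\<in>S (Suc n). F N n = v" by blast
  from const obtain f where f: "\<And>n N. N \<in> S (Suc n) \<Longrightarrow> F N n = f n" by metis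
  have anti: "S m \<subseteq> S n" if "n \<le> m" for n m
    using lift_Suc_antimono_le[of S, OF sub that] .
  have "P m f" for m
  proof -
    \<comment> \<open>An index \<open>N \<ge> m\<close> in \<open>S m\<close> serves both purposes:
      \<open>F N\<close> satisfies \<open>P m\<close> and agrees with \<open>f\<close> below
      \<open>m\<close>.\<close>
    have "\<not> S m \<subseteq> {..<m}" using inf[of m] finite_subset by blast
    then obtain N where N: "N \<in> S m" "m \<le> N" by force
    show ?thesis
    proof (rule local)
      show "P m (F N)" using F(2) N(2) .
      show "F N n = f n" if "n < m" for n
        using N(1) anti[of "Suc n" m] that by (intro f) auto
    qed
  qed
  then show ?thesis by blast
qed

lemma annihilates_cong:
  assumes "\<And>i n. i < s \<Longrightarrow> n < m \<Longrightarrow> fps_nth (\<alpha> i) n = fps_nth (\<alpha>' i) n"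
  shows "annihilates s m \<alpha> k \<longleftrightarrow> annihilates s m \<alpha>' k"
  unfolding annihilates_def fps_sum_nth fps_mult_nth using assms by (auto intro!: sum.cong)

lemma short_relation_cong:
  assumes "\<And>i n. i < s \<Longrightarrow> n < m \<Longrightarrow> fps_nth (\<alpha> i) n = fps_nth (\<alpha>' i) n"
  shows "short_relation s m M \<alpha> \<longleftrightarrow> short_relation s m M \<alpha>'"
  unfolding short_relation_def using annihilates_cong[OF assms] by simp

lemma exists_good_tuple:
  assumes "s \<ge> 2" and M: "\<And>m. M m \<le> m"
    and less: "\<And>n. (\<Sum>m | m \<in> {1..n} \<and> M m > 0.
      4 * real (M m + 1) ^ (s - 1) * real CARD('a) ^ M m / real CARD('a) ^ m) < 1"
  shows "\<exists>\<alpha> :: nat \<Rightarrow> 'a::{field,finite} fps. \<alpha> 0 = 1 \<and> (\<forall>i<s. fps_nth (\<alpha> i) 0 \<noteq> 0) \<and>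
    (\<forall>m\<ge>1. \<not> short_relation s m (M m) \<alpha>)"
proof -
  \<comment> \<open>Letter \<open>n\<close> collects the coefficients of \<open>x ^ n\<close> of all
    components, so a sequence of letters is a tuple of power series.\<close>
  define tup where "tup f = (\<lambda>i. Abs_fps (\<lambda>n. f n i))" for f :: "nat \<Rightarrow> nat \<Rightarrow> 'a"
  \<comment> \<open>Each \<open>P m\<close> must be decided by the letters below \<open>m\<close>:
    the condition that component 0 equals 1 is demanded only that far, and the unit condition, which
    reads letter 0, only for \<open>m \<ge> 1\<close>.\<close>
  define P where "P m f \<longleftrightarrow> m \<ge> 1 \<longrightarrow> (\<forall>n<m. f n 0 = (if n = 0 then 1 else 0)) \<and>
    (\<forall>i<s. f 0 i \<noteq> 0) \<and> \<not> short_relation s m (M m) (tup f)" for m and f :: "nat \<Rightarrow> nat \<Rightarrow> 'a"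
  have "\<exists>f. \<forall>m. P m f"
  proof (rule Koenig_finite_alphabet)
    show "finite ({..<s} \<rightarrow>\<^sub>E (UNIV :: 'a set))" by (simp add: finite_PiE)
    show "P m g" if eq: "\<And>n. n < m \<Longrightarrow> f n = g n" and "P m f" for m f g
    proof -
      have "short_relation s m (M m) (tup f) \<longleftrightarrow> short_relation s m (M m) (tup g)"
        by (rule short_relation_cong) (simp add: tup_def eq)
      with \<open>P m f\<close> eq show ?thesis unfolding P_def by fastforce
    qed
    show "\<exists>f. (\<forall>n. f n \<in> {..<s} \<rightarrow>\<^sub>E (UNIV :: 'a set)) \<and> (\<forall>m\<le>N. P m f)" for N
    proof -
      \<comment> \<open>Truncating at \<open>Suc N\<close> keeps the level positive when
        \<open>N = 0\<close>.\<close>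
      obtain \<alpha> :: "nat \<Rightarrow> 'a fps" where \<alpha>: "\<alpha> \<in> unit_tuples s (Suc N)"
        and good: "\<And>m. m \<in> {1..Suc N} \<Longrightarrow> \<not> short_relation s m (M m) \<alpha>"
        using exists_good_unit_tuple[of s "Suc N" M, OF \<open>s \<ge> 2\<close> _ M less] by auto
      define f where "f n = (\<lambda>i\<in>{..<s}. fps_nth (\<alpha> i) n)" for n
      have mem: "\<alpha> i \<in> (if i = 0 then {1} else unit_fps_box (Suc N))" if "i < s" for i
        using \<alpha> that by (auto simp only: unit_tuples_def PiE_iff mem_Collect_eq lessThan_iff)
      have "\<alpha> 0 = 1" using mem[of 0] \<open>s \<ge> 2\<close> by simp
      moreover have "fps_nth (\<alpha> i) 0 \<noteq> 0" if "i < s" for i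
        using mem[OF that] by (cases "i = 0") (auto simp: unit_fps_box_def)
      moreover have "short_relation s m (M m) (tup f) \<longleftrightarrow> short_relation s m (M m) \<alpha>" for m
        by (rule short_relation_cong) (simp add: tup_def f_def)
      ultimately have "P m f" if "m \<le> N" for m
        using good[of m] \<open>s \<ge> 2\<close> that unfolding P_def f_def by auto
      moreover have "f n \<in> {..<s} \<rightarrow>\<^sub>E UNIV" for n by (simp add: f_def)
      ultimately show ?thesis by blast
    qed
  qed
  then obtain f where f: "\<And>m. P m f" by blast
  have "tup f 0 = 1"
  proof (rule fps_ext)
    show "fps_nth (tup f 0) n = fps_nth 1 n" for n
      using f[of "Suc n"] by (simp add: P_def tup_def)
  qed
  moreover have "\<forall>i<s. fps_nth (tup f i) 0 \<noteq> 0"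
    using f[of 1] by (simp add: P_def tup_def)
  moreover have "\<forall>m\<ge>1. \<not> short_relation s m (M m) (tup f)"
    using f by (simp add: P_def)
  ultimately show ?thesis by blast
qed

section \<open>Digital nets from independent rows\<close>

text \<open>Gaussian elimination by induction on the rows: each independent row determines one
  unknown and divides the number of solutions by \<open>q\<close>. The product form avoids a
  subtraction in the exponent.\<close>

lemma card_solutions_independent_system:
  fixes A :: "'j \<Rightarrow> 'i \<Rightarrow> 'a::{field,finite}"
  assumes "finite J" "finite I"
    and "\<And>c. (\<And>r. r \<in> I \<Longrightarrow> (\<Sum>j\<in>J. c j * A j r) = 0) \<Longrightarrow> (\<And>j. j \<in> J \<Longrightarrow> c j = 0)"
  shows "card {x \<in> I \<rightarrow>\<^sub>E UNIV. \<forall>j\<in>J. (\<Sum>r\<in>I. A j r * x r) = y j} * CARD('a) ^ card J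
    = CARD('a) ^ card I"
  using assms
proof (induction J arbitrary: I A y rule: finite_induct)
  case empty
  then show ?case by (simp add: card_PiE)
next
  case (insert p J)
  \<comment> \<open>Testing independence on the unit vector at \<open>p\<close> shows that row
    \<open>p\<close> is nonzero and so provides a pivot column \<open>r\<close>.\<close>
  let ?c = "(\<lambda>j. 0)(p := 1 :: 'a)"
  have "\<exists>r\<in>I. A p r \<noteq> 0"
  proof (rule ccontr)
    assume "\<not> ?thesis"
    then have "(\<Sum>j\<in>insert p J. ?c j * A j r) = 0" if "r \<in> I" for r
      using that by (intro sum.neutral) auto
    from insert.prems(2)[OF this, of p] show False by simp
  qed
  then obtain r where r: "r \<in> I" "A p r \<noteq> 0" by blast
  define a where "a = A p r"
  have "a \<noteq> 0" using r by (simp add: a_def)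
  define I' where "I' = I - {r}"
  have I: "I = insert r I'" "r \<notin> I'" "finite I'" using r insert.prems(1) by (auto simp: I'_def)
  \<comment> \<open>Subtracting the right multiple of row \<open>p\<close> clears column
    \<open>r\<close> in every other row; \<open>z\<close> is the matching right-hand side.\<close>
  define B where "B j l = A j l - A j r / a * A p l" for j l
  define z where "z j = y j - A j r / a * y p" for j
  define sols where "sols = {x \<in> I \<rightarrow>\<^sub>E UNIV. \<forall>j\<in>insert p J. (\<Sum>r\<in>I. A j r * x r) = y j}"
  define sols' where "sols' = {x \<in> I' \<rightarrow>\<^sub>E UNIV. \<forall>j\<in>J. (\<Sum>r\<in>I'. B j r * x r) = z j}"
  have indep: "c j = 0" if c: "\<And>l. l \<in> I' \<Longrightarrow> (\<Sum>j\<in>J. c j * B j l) = 0" and j: "j \<in> J" for c j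
  proof -
    \<comment> \<open>With this coefficient at row \<open>p\<close>, a combination of the rows of
      \<open>B\<close> becomes a combination of the original rows.\<close>
    define c' where "c' = c(p := - (\<Sum>j\<in>J. c j * (A j r / a)))"
    have expand: "(\<Sum>j\<in>insert p J. c' j * A j l) = (\<Sum>j\<in>J. c j * B j l)" for l
    proof -
      have "(\<Sum>j\<in>insert p J. c' j * A j l) = c' p * A p l + (\<Sum>j\<in>J. c' j * A j l)"
        using insert.hyps by simp
      also have "(\<Sum>j\<in>J. c' j * A j l) = (\<Sum>j\<in>J. c j * A j l)"
        using insert.hyps by (intro sum.cong) (auto simp: c'_def)
      also have "c' p * A p l = - (\<Sum>j\<in>J. c j * (A j r / a * A p l))"
        by (simp add: c'_def sum_distrib_right mult.assoc)
      finally show ?thesis by (simp add: B_def right_diff_distrib sum_subtractf)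
    qed
    have "B j r = 0" for j using \<open>a \<noteq> 0\<close> by (simp add: B_def a_def)
    then have "(\<Sum>j\<in>insert p J. c' j * A j l) = 0" if "l \<in> I" for l
      using that c[of l] unfolding expand I(1) by auto
    from insert.prems(2)[OF this, of j] j insert.hyps show ?thesis
      by (auto simp: c'_def split: if_splits)
  qed
  have split: "(\<Sum>l\<in>I. A j l * x l) = A j r * x r + (\<Sum>l\<in>I'. A j l * x l)" for j x
    using I by simp
  \<comment> \<open>Back substitution: equation \<open>p\<close> solved for the unknown at the pivot
    \<open>r\<close>.\<close>
  define ext where "ext x = (\<lambda>l\<in>I. if l = r then (y p - (\<Sum>l\<in>I'. A p l * x l)) / a else x l)" for x
  have ext_sum: "(\<Sum>l\<in>I'. A j l * ext x l) = (\<Sum>l\<in>I'. A j l * x l)" for j x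
    using I by (intro sum.cong) (auto simp: ext_def)
  have ext_r: "ext x r = (y p - (\<Sum>l\<in>I'. A p l * x l)) / a" for x using r by (simp add: ext_def)
  have elim: "(\<Sum>l\<in>I'. B j l * x l) = (\<Sum>l\<in>I'. A j l * x l) - A j r / a * (\<Sum>l\<in>I'. A p l * x l)" for j x
    by (simp add: B_def left_diff_distrib sum_subtractf sum_distrib_left mult.assoc)
  have "bij_betw (\<lambda>x. restrict x I') sols sols'"
  proof (rule bij_betw_byWitness[where f' = ext])
    have x_r: "x r = (y p - (\<Sum>l\<in>I'. A p l * x l)) / a" if "x \<in> sols" for x
      using that \<open>a \<noteq> 0\<close> split[of p x] by (simp add: sols_def a_def field_simps)
    show "\<forall>x\<in>sols. ext (restrict x I') = x"
    proof
      fix x assume x: "x \<in> sols"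
      show "ext (restrict x I') = x"
      proof (rule ext)
        fix l
        show "ext (restrict x I') l = x l"
          using x x_r[OF x] I unfolding ext_def sols_def by (auto simp: PiE_iff extensional_def)
      qed
    qed
    show "\<forall>x\<in>sols'. restrict (ext x) I' = x"
    proof
      fix x assume "x \<in> sols'"
      then show "restrict (ext x) I' = x"
        using I unfolding ext_def sols'_def by (auto simp: PiE_iff extensional_def fun_eq_iff)
    qed
    show "(\<lambda>x. restrict x I') ` sols \<subseteq> sols'"
    proof (rule image_subsetI)
      fix x assume x: "x \<in> sols"
      have "(\<Sum>l\<in>I'. B j l * x l) = z j" if "j \<in> J" for j
      proof -
        have "y j = A j r * x r + (\<Sum>l\<in>I'. A j l * x l)" using x that split[of j x] by (simp add: sols_def)
        then show ?thesis unfolding elim x_r[OF x] z_def using \<open>a \<noteq> 0\<close> by (simp add: field_simps)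
      qed
      then show "restrict x I' \<in> sols'" by (simp add: sols'_def)
    qed
    show "ext ` sols' \<subseteq> sols"
    proof (rule image_subsetI)
      fix x assume x: "x \<in> sols'"
      have "(\<Sum>l\<in>I. A j l * ext x l) = y j" if "j \<in> insert p J" for j
      proof (cases "j = p")
        case True
        then show ?thesis unfolding split ext_sum ext_r using \<open>a \<noteq> 0\<close> by (simp add: a_def)
      next
        case False
        then have "(\<Sum>l\<in>I'. B j l * x l) = z j" using x that by (simp add: sols'_def)
        then show ?thesis unfolding split ext_sum ext_r elim z_def using \<open>a \<noteq> 0\<close>
          by (simp add: field_simps)
      qed
      then show "ext x \<in> sols" by (simp add: sols_def ext_def)
    qed
  qed
  then have "card sols = card sols'" by (rule bij_betw_same_card)
  moreover have "card sols' * CARD('a) ^ card J = CARD('a) ^ card I'"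
    unfolding sols'_def by (rule insert.IH[OF I(3)]) (rule indep)
  ultimately have "card sols * CARD('a) ^ card (insert p J) = CARD('a) ^ card I"
    using insert.hyps I by simp
  then show ?case unfolding sols_def .
qed

section \<open>Digit expansions and elementary intervals\<close>

text \<open>Horner scheme with digit 0 the most significant, so that the value numbers the interval
  of length \<open>1 / q ^ d\<close> selected by the first \<open>d\<close> digits.\<close>

fun digit_value :: "nat \<Rightarrow> (nat \<Rightarrow> nat) \<Rightarrow> nat \<Rightarrow> nat" where
  "digit_value q y 0 = 0"
| "digit_value q y (Suc d) = q * digit_value q y d + y d"

lemma truncation_eq_digit_value:
  assumes "q > 0"
  shows "truncation q d y = real (digit_value q y d) / real q ^ d"
proof (induction d)
  case 0
  then show ?case by (simp add: truncation_def)
next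
  case (Suc d)
  have "truncation q (Suc d) y = truncation q d y + real (y d) / real q ^ Suc d"
    by (simp add: truncation_def)
  then show ?case using assms by (simp add: Suc.IH field_simps)
qed

lemma digit_value_less:
  assumes "\<And>j. j < d \<Longrightarrow> y j < q"
  shows "digit_value q y d < q ^ d"
  using assms
proof (induction d)
  case (Suc d)
  have "digit_value q y d < q ^ d" using Suc by simp
  then have "q * (digit_value q y d + 1) \<le> q * q ^ d" by (intro mult_le_mono) auto
  moreover have "y d < q" using Suc.prems by simp
  ultimately show ?case by (simp add: algebra_simps)
qed simp

lemma digit_value_inj:
  assumes "\<And>j. j < d \<Longrightarrow> y j < q" "\<And>j. j < d \<Longrightarrow> z j < q" "digit_value q y d = digit_value q z d" "j < d"
  shows "y j = z j"
  using assms
proof (induction d)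
  case (Suc d)
  have lt: "y d < q" "z d < q" using Suc.prems by auto
  have eq: "q * digit_value q y d + y d = q * digit_value q z d + z d" using Suc.prems by simp
  have "y d = z d" using arg_cong[OF eq, of "\<lambda>x. x mod q"] lt by simp
  moreover from this have "digit_value q y d = digit_value q z d" using eq lt by simp
  ultimately show ?case using Suc by (cases "j = d") auto
qed simp

lemma digit_value_surj:
  assumes "q > 0" "a < q ^ d"
  obtains y where "\<And>j. y j < q" "digit_value q y d = a"
proof -
  have "\<exists>y. (\<forall>j. y j < q) \<and> digit_value q y d = a"
    using assms
  proof (induction d arbitrary: a)
    case 0
    then show ?case by (intro exI[of _ "\<lambda>_. 0"]) simp
  next
    case (Suc d)
    have "a div q < q ^ d" using Suc.prems by (simp add: less_mult_imp_div_less mult.commute)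
    with Suc obtain y where y: "\<And>j. y j < q" "digit_value q y d = a div q" by blast
    have cong: "digit_value q (y(d := c)) e = digit_value q y e" if "e \<le> d" for c e
      using that by (induction e) auto
    have "digit_value q (y(d := a mod q)) (Suc d) = a"
      using y(2) cong[of d "a mod q"] by (simp del: fun_upd_apply add: fun_upd_same)
    moreover have "(y(d := a mod q)) j < q" for j using y(1) Suc.prems by simp
    ultimately show ?case by blast
  qed
  then show thesis using that by blast
qed

text \<open>The digits from \<open>d\<close> to \<open>m - 1\<close> contribute at most the
  telescoping sum \<open>1 / q ^ d - 1 / q ^ m\<close>. Stopping at \<open>m\<close> keeps this
  strictly below \<open>1 / q ^ d\<close> even if all these digits are \<open>q - 1\<close>, as
  half-open intervals require.\<close>

lemma truncation_bounds:
  assumes "\<And>j. y j < q" "d \<le> m"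
  shows "truncation q d y \<le> truncation q m y" "truncation q m y < truncation q d y + 1 / real q ^ d"
proof -
  have q: "q > 0" using assms(1)[of 0] by simp
  have "truncation q m y = truncation q d y + (\<Sum>j\<in>{d..<m}. real (y j) / real q ^ Suc j)"
    unfolding truncation_def lessThan_atLeast0 using assms(2) by (simp add: sum.atLeastLessThan_concat)
  moreover have "0 \<le> (\<Sum>j\<in>{d..<m}. real (y j) / real q ^ Suc j)" by (intro sum_nonneg) simp
  moreover have "(\<Sum>j\<in>{d..<m}. real (y j) / real q ^ Suc j) < 1 / real q ^ d"
  proof -
    have "(\<Sum>j\<in>{d..<m}. real (y j) / real q ^ Suc j) \<le> (\<Sum>j\<in>{d..<m}. 1 / real q ^ j - 1 / real q ^ Suc j)"
    proof (rule sum_mono)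
      fix j
      have "real (y j) + 1 \<le> real q" using assms(1)[of j] by linarith
      then show "real (y j) / real q ^ Suc j \<le> 1 / real q ^ j - 1 / real q ^ Suc j"
        using q by (simp add: field_simps)
    qed
    also have "\<dots> = 1 / real q ^ d - 1 / real q ^ m"
      using assms(2) sum_Suc_diff'[of d m "\<lambda>j. - (1 / real q ^ j)"] by simp
    also have "\<dots> < 1 / real q ^ d" using q by simp
    finally show ?thesis .
  qed
  ultimately show "truncation q d y \<le> truncation q m y" "truncation q m y < truncation q d y + 1 / real q ^ d"
    by linarith+
qed

text \<open>A truncated point lies in the interval numbered by its own digit value, and distinct
  numbers give disjoint intervals. Membership in a box thus becomes a set of equations between
  digits.\<close>

lemma truncation_mem_interval_iff:
  assumes y: "\<And>j. y j < q" and z: "\<And>j. z j < q" and "d \<le> m"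
  shows "truncation q m y \<in> {real (digit_value q z d) / real q ^ d ..< (real (digit_value q z d) + 1) / real q ^ d}
    \<longleftrightarrow> (\<forall>j<d. y j = z j)"
proof -
  have q: "q > 0" using y[of 0] by simp
  let ?Y = "digit_value q y d" and ?Z = "digit_value q z d"
  have b: "real ?Y / real q ^ d \<le> truncation q m y" "truncation q m y < (real ?Y + 1) / real q ^ d"
    using truncation_bounds[of y q, OF y \<open>d \<le> m\<close>] truncation_eq_digit_value[OF q, of d y]
    by (simp_all add: add_divide_distrib)
  have "truncation q m y \<in> {real ?Z / real q ^ d ..< (real ?Z + 1) / real q ^ d} \<longleftrightarrow> ?Y = ?Z"
  proof
    assume "truncation q m y \<in> {real ?Z / real q ^ d ..< (real ?Z + 1) / real q ^ d}"
    then have "real ?Z / real q ^ d < (real ?Y + 1) / real q ^ d"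
      "real ?Y / real q ^ d < (real ?Z + 1) / real q ^ d"
      using b by auto
    then show "?Y = ?Z" using q by (simp add: divide_less_cancel)
  next
    assume "?Y = ?Z"
    then show "truncation q m y \<in> {real ?Z / real q ^ d ..< (real ?Z + 1) / real q ^ d}" using b by simp
  qed
  also have "\<dots> \<longleftrightarrow> (\<forall>j<d. y j = z j)"
  proof
    assume "?Y = ?Z"
    then show "\<forall>j<d. y j = z j" using digit_value_inj[of d y q z] y z by blast
  next
    assume "\<forall>j<d. y j = z j"
    then have "digit_value q y e = digit_value q z e" if "e \<le> d" for e
      using that by (induction e) auto
    then show "?Y = ?Z" by simp
  qed
  finally show ?thesis .
qed

lemma mod_power_eq_of_nat_digit_eq:
  assumes "\<And>r. r < m \<Longrightarrow> nat_digit q n r = nat_digit q n' r"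
  shows "n mod q ^ m = n' mod q ^ m"
  using assms
proof (induction m)
  case (Suc m)
  have "n mod q ^ Suc m = q ^ m * nat_digit q n m + n mod q ^ m" for n
    unfolding nat_digit_def power_Suc2 by (rule mod_mult2_eq)
  then show ?case using Suc by simp
qed simp

lemma finite_nonzero_digits:
  assumes "q \<ge> 2"
  shows "finite {r. nat_digit q n r \<noteq> 0}"
proof (rule finite_subset)
  show "{r. nat_digit q n r \<noteq> 0} \<subseteq> {..<n}"
  proof
    fix r assume "r \<in> {r. nat_digit q n r \<noteq> 0}"
    then have "n div q ^ r \<noteq> 0" by (auto simp: nat_digit_def intro: ccontr)
    then have "q ^ r \<le> n" by (meson div_less not_less)
    moreover have "r < q ^ r" using assms by (simp add: power_gt_expt)
    ultimately show "r \<in> {..<n}" by simp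
  qed
qed simp

text \<open>Over an aligned block of \<open>q ^ m\<close> indices the quotient
  \<open>n div q ^ m\<close> is constant, so the second summand is a fixed shift and only the first
  varies.\<close>

lemma digital_product_split:
  fixes \<phi> :: "nat \<Rightarrow> 'a::{field,finite}"
  assumes "\<phi> 0 = 0"
  shows "digital_product \<phi> C n i j = (\<Sum>r<m. C i j r * \<phi> (nat_digit CARD('a) n r))
    + digital_product \<phi> (\<lambda>i j r. C i j (r + m)) (n div CARD('a) ^ m) i j"
proof -
  let ?q = "CARD('a)"
  let ?t = "\<lambda>r. C i j r * \<phi> (nat_digit ?q n r)"
  have shift: "nat_digit ?q (n div ?q ^ m) r = nat_digit ?q n (r + m)" for r
    by (simp add: nat_digit_def power_add div_mult2_eq mult.commute)
  have fin: "finite {r. nat_digit ?q n r \<noteq> 0}"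
    using card_field_ge_2[where 'a='a] by (rule finite_nonzero_digits)
  have "digital_product \<phi> C n i j = (\<Sum>r\<in>{..<m} \<union> {r. m \<le> r \<and> nat_digit ?q n r \<noteq> 0}. ?t r)"
    unfolding digital_product_def using fin assms
    by (intro sum.mono_neutral_left) (auto intro: finite_subset[OF _ fin])
  also have "\<dots> = (\<Sum>r<m. ?t r) + (\<Sum>r | m \<le> r \<and> nat_digit ?q n r \<noteq> 0. ?t r)"
    by (intro sum.union_disjoint) (auto intro: finite_subset[OF _ fin])
  also have "(\<Sum>r | m \<le> r \<and> nat_digit ?q n r \<noteq> 0. ?t r) = (\<Sum>r | nat_digit ?q n (r + m) \<noteq> 0. ?t (r + m))"
    by (rule sum.reindex_bij_witness[of _ "\<lambda>r. r + m" "\<lambda>r. r - m"]) auto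
  also have "\<dots> = digital_product \<phi> (\<lambda>i j r. C i j (r + m)) (n div ?q ^ m) i j"
    by (simp add: digital_product_def shift)
  finally show ?thesis .
qed

lemma digital_digit_less:
  fixes \<phi> :: "nat \<Rightarrow> 'a::{field,finite}"
  assumes "digit_bijection \<phi>"
  shows "digital_digit \<phi> C k i j < CARD('a)"
proof -
  have "digital_product \<phi> C k i j \<in> \<phi> ` {..<CARD('a)}"
    using assms by (simp add: digit_bijection_def bij_betw_def)
  from inv_into_into[OF this] show ?thesis by (simp add: digital_digit_def)
qed

lemma digital_digit_eq_iff:
  fixes \<phi> :: "nat \<Rightarrow> 'a::{field,finite}"
  assumes "digit_bijection \<phi>" "z < CARD('a)"
  shows "digital_digit \<phi> C k i j = z \<longleftrightarrow> digital_product \<phi> C k i j = \<phi> z"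
proof -
  have bij: "inj_on \<phi> {..<CARD('a)}" "\<phi> ` {..<CARD('a)} = UNIV"
    using assms(1) by (auto simp: digit_bijection_def bij_betw_def)
  show ?thesis
    unfolding digital_digit_def using bij assms(2)
    by (metis UNIV_I f_inv_into_f inv_into_f_f lessThan_iff)
qed

text \<open>The quotient by \<open>q ^ m\<close> is \<open>k\<close> throughout the block, so the
  lower digits determine \<open>n\<close>; surjectivity follows by comparing cardinalities.\<close>

lemma bij_betw_block_digits:
  fixes \<phi> :: "nat \<Rightarrow> 'a::{field,finite}"
  assumes "digit_bijection \<phi>"
  shows "bij_betw (\<lambda>n. \<lambda>r\<in>{..<m}. \<phi> (nat_digit CARD('a) n r))
    {k * CARD('a) ^ m ..< (k + 1) * CARD('a) ^ m} ({..<m} \<rightarrow>\<^sub>E UNIV)"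
proof -
  let ?q = "CARD('a)" and ?f = "\<lambda>n. \<lambda>r\<in>{..<m}. \<phi> (nat_digit CARD('a) n r)"
  let ?K = "{k * CARD('a) ^ m ..< (k + 1) * CARD('a) ^ m}"
  have q: "?q > 0" by simp
  have inj: "inj_on ?f ?K"
  proof (rule inj_onI)
    fix n n' assume n: "n \<in> ?K" "n' \<in> ?K" and eq: "?f n = ?f n'"
    have "nat_digit ?q n r = nat_digit ?q n' r" if "r < m" for r
    proof -
      have "\<phi> (nat_digit ?q n r) = \<phi> (nat_digit ?q n' r)"
        using fun_cong[OF eq, of r] that by simp
      moreover have "inj_on \<phi> {..<?q}" using assms by (simp add: digit_bijection_def bij_betw_def)
      ultimately show ?thesis using q by (auto simp: nat_digit_def dest: inj_onD)
    qed
    then have "n mod ?q ^ m = n' mod ?q ^ m" by (rule mod_power_eq_of_nat_digit_eq)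
    moreover have "x div ?q ^ m = k" if "x \<in> ?K" for x
      using that by (intro div_nat_eqI) (auto simp: mult.commute)
    ultimately show "n = n'" using n by (metis div_mult_mod_eq)
  qed
  moreover have "?f ` ?K \<subseteq> {..<m} \<rightarrow>\<^sub>E UNIV" by (rule image_subsetI) (rule restrict_PiE_iff[THEN iffD2], simp)
  moreover have "card ({..<m} \<rightarrow>\<^sub>E (UNIV :: 'a set)) = card ?K"
    by (simp add: card_PiE)
  ultimately have "?f ` ?K = {..<m} \<rightarrow>\<^sub>E UNIV"
    by (intro card_subset_eq) (simp_all add: finite_PiE card_image)
  with inj show ?thesis by (simp add: bij_betw_def)
qed

lemma bij_betw_Collect_image:
  "bij_betw f A B \<Longrightarrow> bij_betw f {x \<in> A. P (f x)} {y \<in> B. P y}"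
  by (auto simp: bij_betw_def inj_on_def)

text \<open>A box of the relevant volume prescribes \<open>m - t\<close> digits in total. These are
  \<open>m - t\<close> independent linear equations for the \<open>m\<close> lower digits of the
  index, hence \<open>q ^ t\<close> solutions; the block number \<open>k\<close> enters only the
  right-hand side.\<close>

lemma is_net_of_independent_rows:
  fixes \<phi> :: "nat \<Rightarrow> 'a::{field,finite}"
  assumes \<phi>: "digit_bijection \<phi>" and "t \<le> m"
    and indep: "\<And>d c. (\<Sum>i<s. d i) = m - t \<Longrightarrow>
      (\<And>r. r < m \<Longrightarrow> (\<Sum>i<s. \<Sum>j<d i. c i j * C i j r) = 0) \<Longrightarrow> (\<And>i j. i < s \<Longrightarrow> j < d i \<Longrightarrow> c i j = 0)"
  shows "is_net CARD('a) t m s {k * CARD('a) ^ m ..< (k + 1) * CARD('a) ^ m}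
    (\<lambda>n i. truncation CARD('a) m (digital_digit \<phi> C n i))"
  unfolding is_net_def
proof (intro conjI allI impI ballI)
  let ?q = "CARD('a)" and ?K = "{k * CARD('a) ^ m ..< (k + 1) * CARD('a) ^ m}"
  let ?x = "\<lambda>n i. truncation CARD('a) m (digital_digit \<phi> C n i)"
  have q2: "?q \<ge> 2" by (rule card_field_ge_2)
  note dd = digital_digit_less[OF \<phi>]
  show "finite ?K" by simp
  show "card ?K = ?q ^ m" by simp
  show "?x n i \<in> {0..<1}" for n i
    using truncation_bounds[of "digital_digit \<phi> C n i" ?q 0 m] dd by (simp add: truncation_def)
  fix d a :: "nat \<Rightarrow> nat"
  assume "(\<forall>i<s. a i < ?q ^ d i) \<and> (\<Prod>i<s. 1 / real ?q ^ d i) = real ?q powi (int t - int m)"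
  then have a: "\<And>i. i < s \<Longrightarrow> a i < ?q ^ d i"
    and vol: "(\<Prod>i<s. 1 / real ?q ^ d i) = real ?q powi (int t - int m)" by auto
  have "(\<Prod>i<s. 1 / real ?q ^ d i) = 1 / real ?q ^ (\<Sum>i<s. d i)"
    by (simp add: prod_dividef power_sum)
  moreover have "int t - int m = - int (m - t)" using \<open>t \<le> m\<close> by simp
  then have "real ?q powi (int t - int m) = 1 / real ?q ^ (m - t)"
    by (simp only: power_int_minus power_int_of_nat inverse_eq_divide)
  ultimately have "1 / real ?q ^ (\<Sum>i<s. d i) = 1 / real ?q ^ (m - t)"
    using vol by argo
  then have "real ?q ^ (\<Sum>i<s. d i) = real ?q ^ (m - t)"
    by (metis div_by_1 divide_divide_eq_right mult_1)
  moreover have "1 < real ?q" using q2 by linarith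
  ultimately have sum_d: "(\<Sum>i<s. d i) = m - t"
    by (simp only: power_inject_exp)
  have d_le: "d i \<le> m" if "i < s" for i
  proof -
    have "d i \<le> (\<Sum>i<s. d i)" using that by (intro member_le_sum) auto
    then show ?thesis using sum_d by simp
  qed
  have "\<exists>z. (\<forall>j. z j < ?q) \<and> digit_value ?q z (d i) = a i" if "i < s" for i
    using digit_value_surj[OF _ a[OF that]] by (metis zero_less_card_finite)
  then obtain z where z: "\<And>i j. i < s \<Longrightarrow> z i j < ?q" "\<And>i. i < s \<Longrightarrow> digit_value ?q (z i) (d i) = a i"
    by metis
  let ?J = "Sigma {..<s} (\<lambda>i. {..<d i})"
  \<comment> \<open>The prescribed digit minus the fixed contribution of the digits from
    \<open>m\<close> on, which are those of \<open>k\<close>.\<close>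
  let ?w = "\<lambda>(i, j). \<phi> (z i j) - digital_product \<phi> (\<lambda>i j r. C i j (r + m)) k i j"
  let ?A = "\<lambda>(i, j) r. C i j r"
  let ?f = "\<lambda>n. \<lambda>r\<in>{..<m}. \<phi> (nat_digit CARD('a) n r)"
  let ?P = "\<lambda>x. \<forall>p\<in>?J. (\<Sum>r<m. ?A p r * x r) = ?w p"
  have mem: "(\<forall>i<s. ?x n i \<in> {real (a i) / real ?q ^ d i ..< (real (a i) + 1) / real ?q ^ d i}) \<longleftrightarrow> ?P (?f n)"
    if n: "n \<in> ?K" for n
  proof -
    have "n div ?q ^ m = k" using n by (intro div_nat_eqI) (auto simp: mult.commute)
    then have "digital_product \<phi> C n i j = (\<Sum>r<m. C i j r * ?f n r)
      + digital_product \<phi> (\<lambda>i j r. C i j (r + m)) k i j" for i j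
      using digital_product_split[of \<phi> C n i j m] \<phi> by (simp add: digit_bijection_def)
    then have "digital_digit \<phi> C n i j = z i j \<longleftrightarrow> (\<Sum>r<m. ?A (i, j) r * ?f n r) = ?w (i, j)" if "i < s" for i j
      using digital_digit_eq_iff[OF \<phi> z(1)[OF that], of C n i j j] by (auto simp: algebra_simps)
    moreover have "?x n i \<in> {real (a i) / real ?q ^ d i ..< (real (a i) + 1) / real ?q ^ d i} \<longleftrightarrow>
      (\<forall>j<d i. digital_digit \<phi> C n i j = z i j)" if "i < s" for i
      using truncation_mem_interval_iff[of "digital_digit \<phi> C n i" ?q "z i" "d i" m] dd z[OF that] d_le[OF that]
      by simp
    ultimately show ?thesis by (auto simp del: restrict_apply)
  qed
  have card_J: "card ?J = m - t" by (simp add: sum_d)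
  have bij: "bij_betw ?f {n\<in>?K. ?P (?f n)} {x \<in> {..<m} \<rightarrow>\<^sub>E UNIV. ?P x}"
    using bij_betw_block_digits[OF \<phi>, of m k] by (rule bij_betw_Collect_image)
  have "card {n\<in>?K. \<forall>i<s. ?x n i \<in> {real (a i) / real ?q ^ d i ..< (real (a i) + 1) / real ?q ^ d i}}
    = card {n\<in>?K. ?P (?f n)}"
    using mem by (intro arg_cong[of _ _ card]) blast
  also have "\<dots> = card {x \<in> {..<m} \<rightarrow>\<^sub>E UNIV. ?P x}" using bij by (rule bij_betw_same_card)
  finally have eq: "card {n\<in>?K. \<forall>i<s. ?x n i \<in> {real (a i) / real ?q ^ d i ..< (real (a i) + 1) / real ?q ^ d i}}
    = card {x \<in> {..<m} \<rightarrow>\<^sub>E UNIV. ?P x}" .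
  have "card {x \<in> {..<m} \<rightarrow>\<^sub>E UNIV. ?P x} * ?q ^ card ?J = ?q ^ card {..<m}"
  proof (rule card_solutions_independent_system)
    fix c :: "nat \<times> nat \<Rightarrow> 'a" and p
    assume c: "\<And>r. r \<in> {..<m} \<Longrightarrow> (\<Sum>p\<in>?J. c p * ?A p r) = 0" and "p \<in> ?J"
    then obtain i j where p: "p = (i, j)" "i < s" "j < d i" by auto
    have "(\<Sum>i<s. \<Sum>j<d i. c (i, j) * C i j r) = 0" if "r < m" for r
      using c[of r] that by (simp add: sum.Sigma split_def)
    from indep[OF sum_d this, of i j] p show "c p = 0" by simp
  qed auto
  then have "card {x \<in> {..<m} \<rightarrow>\<^sub>E UNIV. ?P x} * ?q ^ (m - t) = ?q ^ t * ?q ^ (m - t)"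
    unfolding card_J using \<open>t \<le> m\<close> by (simp flip: power_add)
  then show "card {n\<in>?K. \<forall>i<s. ?x n i \<in> {real (a i) / real ?q ^ d i ..< (real (a i) + 1) / real ?q ^ d i}} = ?q ^ t"
    unfolding eq by simp
qed

lemma digital_sequence_sums:
  fixes \<phi> :: "nat \<Rightarrow> 'a::{field,finite}"
  assumes "digit_bijection \<phi>"
  shows "(\<lambda>j. real (digital_digit \<phi> C k i j) / real CARD('a) ^ Suc j) sums digital_sequence \<phi> C k i"
  unfolding digital_sequence_def
proof (rule summable_sums, rule summable_comparison_test')
  have q: "CARD('a) \<ge> 2" by (rule card_field_ge_2)
  then show "summable (\<lambda>j. (1 / real CARD('a)) ^ j)" by (intro summable_geometric) simp
  show "norm (real (digital_digit \<phi> C k i j) / real CARD('a) ^ Suc j) \<le> (1 / real CARD('a)) ^ j" for j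
  proof -
    have "real (digital_digit \<phi> C k i j) / real CARD('a) ^ Suc j \<le> real CARD('a) / real CARD('a) ^ Suc j"
      using digital_digit_less[OF assms, of C k i j] by (intro divide_right_mono) auto
    then show ?thesis using q by (simp add: power_one_over)
  qed
qed

section \<open>Generating matrices of hyperplane sequences\<close>

text \<open>The flattening follows the position convention of \<open>\<theta>\<close> and
  \<open>juxtaposed\<close>, so that inner products become double sums over blocks and
  offsets.\<close>

definition block_vec :: "nat \<Rightarrow> nat \<Rightarrow> (nat \<Rightarrow> nat \<Rightarrow> 'a) \<Rightarrow> 'a vec" where
  "block_vec s m f = vec (s * m) (\<lambda>l. f (l div m) (l mod m))"

lemma sum_blocks:
  fixes f :: "nat \<Rightarrow> nat \<Rightarrow> 'b::comm_monoid_add"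
  assumes "m \<ge> 1"
  shows "(\<Sum>l<s * m. f (l div m) (l mod m)) = (\<Sum>i<s. \<Sum>j<m. f i j)"
proof -
  have "(\<Sum>l<s * m. f (l div m) (l mod m)) = (\<Sum>i<s. \<Sum>l\<in>{i * m..<i * m + m}. f (l div m) (l mod m))"
    by (rule sum.nat_group[symmetric])
  also have "\<dots> = (\<Sum>i<s. \<Sum>j<m. f i j)"
  proof (rule sum.cong[OF refl])
    fix i
    have "(\<Sum>l\<in>{i * m..<i * m + m}. f (l div m) (l mod m)) = (\<Sum>j\<in>{0..<m}. f ((i * m + j) div m) ((i * m + j) mod m))"
      using sum.shift_bounds_nat_ivl[of "\<lambda>l. f (l div m) (l mod m)" 0 "i * m" m]
      by (simp add: add.commute)
    also have "\<dots> = (\<Sum>j<m. f i j)"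
      unfolding lessThan_atLeast0 by (rule sum.cong) auto
    finally show "(\<Sum>l\<in>{i * m..<i * m + m}. f (l div m) (l mod m)) = (\<Sum>j<m. f i j)" .
  qed
  finally show ?thesis .
qed

lemma block_vec_scalar_prod:
  fixes f g :: "nat \<Rightarrow> nat \<Rightarrow> 'a::comm_semiring_0"
  assumes "m \<ge> 1"
  shows "block_vec s m f \<bullet> block_vec s m g = (\<Sum>i<s. \<Sum>j<m. f i j * g i j)"
  using sum_blocks[OF assms, of "\<lambda>i j. f i j * g i j" s]
  by (simp add: scalar_prod_def block_vec_def lessThan_atLeast0)

lemma block_vec_carrier [simp]: "block_vec s m f \<in> carrier_vec (s * m)"
  by (simp add: block_vec_def)

lemma block_vec_eqI:
  assumes "\<And>i j. i < s \<Longrightarrow> j < m \<Longrightarrow> f i j = g i j"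
  shows "block_vec s m f = block_vec s m g"
  unfolding block_vec_def
proof (rule eq_vecI)
  fix l assume "l < dim_vec (vec (s * m) (\<lambda>l. g (l div m) (l mod m)))"
  then have "l < s * m" by simp
  moreover from this have "m > 0" by (cases m) auto
  ultimately show "vec (s * m) (\<lambda>l. f (l div m) (l mod m)) $ l = vec (s * m) (\<lambda>l. g (l div m) (l mod m)) $ l"
    using assms by (simp add: less_mult_imp_div_less)
qed simp

lemma carrier_vec_eq_block_vec:
  assumes "v \<in> carrier_vec (s * m)"
  obtains f where "v = block_vec s m f"
proof (rule that)
  show "v = block_vec s m (\<lambda>i j. v $ (i * m + j))"
    using assms by (intro eq_vecI) (auto simp: block_vec_def)
qed

lemma row_space_juxtaposed:
  fixes C :: "nat \<Rightarrow> nat \<Rightarrow> nat \<Rightarrow> 'a::field"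
  shows "vec_space.row_space (s * m) (juxtaposed s C m)
    = range (\<lambda>u. block_vec s m (\<lambda>i j. \<Sum>r<m. u r * C i j r))"
proof -
  let ?A = "juxtaposed s C m"
  have A: "?A \<in> carrier_mat m (s * m)" by (simp add: juxtaposed_def)
  have prod: "?A\<^sup>T *\<^sub>v y = block_vec s m (\<lambda>i j. \<Sum>r<m. y $ r * C i j r)" if "y \<in> carrier_vec m" for y
  proof (rule eq_vecI)
    fix l assume "l < dim_vec (block_vec s m (\<lambda>i j. \<Sum>r<m. y $ r * C i j r))"
    then have l: "l < s * m" by (simp add: block_vec_def)
    then show "(?A\<^sup>T *\<^sub>v y) $ l = block_vec s m (\<lambda>i j. \<Sum>r<m. y $ r * C i j r) $ l"
      using that by (simp add: block_vec_def juxtaposed_def scalar_prod_def lessThan_atLeast0 mult.commute)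
  qed (simp add: block_vec_def juxtaposed_def)
  have eq: "vec_space.row_space (s * m) ?A = {w \<in> carrier_vec (dim_col ?A). \<exists>y\<in>carrier_vec (dim_row ?A). ?A\<^sup>T *\<^sub>v y = w}"
    by (rule vec_space.row_space_eq[OF A])
  show ?thesis
  proof (intro equalityI subsetI)
    fix w assume "w \<in> vec_space.row_space (s * m) ?A"
    then obtain y where "y \<in> carrier_vec m" "w = ?A\<^sup>T *\<^sub>v y" using A unfolding eq by auto
    then show "w \<in> range (\<lambda>u. block_vec s m (\<lambda>i j. \<Sum>r<m. u r * C i j r))"
      using prod by auto
  next
    fix w assume "w \<in> range (\<lambda>u. block_vec s m (\<lambda>i j. \<Sum>r<m. u r * C i j r))"
    then obtain u where u: "w = block_vec s m (\<lambda>i j. \<Sum>r<m. u r * C i j r)" by blast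
    have "?A\<^sup>T *\<^sub>v vec m u = w"
      unfolding u by (subst prod) (auto intro!: block_vec_eqI sum.cong)
    then show "w \<in> vec_space.row_space (s * m) ?A"
      using A u unfolding eq by (auto intro!: bexI[of _ "vec m u"])
  qed
qed

section \<open>Compatible bases and coordinates\<close>

lemma compatible_basis_mem_R:
  assumes "compatible_bases s \<bb>" "i < s" "j < m"
  shows "\<bb> m i j \<in> R m"
proof -
  have "poly_vs.span (\<bb> m i ` {..<m}) = R m"
    using assms by (auto simp: compatible_bases_def ordered_basis_def)
  then show ?thesis using poly_vs.span_base[of "\<bb> m i j" "\<bb> m i ` {..<m}"] assms(3) by auto
qed

text \<open>Appending a zero coefficient leaves the polynomial unchanged: the coefficients beyond
  the compared ones vanish by the degree bound.\<close>

lemma compatible_basis_stable: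
  assumes "compatible_bases s \<bb>" "i < s" "j < m"
  shows "\<bb> m i j = \<bb> (Suc j) i j"
  using \<open>j < m\<close>
proof (induction m)
  case (Suc m)
  show ?case
  proof (cases "j = m")
    case False
    with Suc have "j < m" by simp
    have "coeff (\<bb> (Suc m) i j) n = coeff (\<bb> m i j) n" for n
    proof -
      consider "n < m" | "n = m" | "n > m" by linarith
      then show ?thesis
      proof cases
        case 1
        then show ?thesis using assms(1,2) \<open>j < m\<close> by (simp add: compatible_bases_def)
      next
        case 2
        have "coeff (\<bb> (Suc m) i j) m = 0" using assms(1,2) \<open>j < m\<close> by (simp add: compatible_bases_def)
        moreover have "coeff (\<bb> m i j) m = 0"
          using compatible_basis_mem_R[OF assms(1,2) \<open>j < m\<close>] by (simp add: R_def coeff_eq_0)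
        ultimately show ?thesis using 2 by simp
      next
        case 3
        then show ?thesis
          using compatible_basis_mem_R[OF assms(1,2) \<open>j < m\<close>] compatible_basis_mem_R[OF assms(1,2) Suc.prems]
          by (simp add: R_def coeff_eq_0)
      qed
    qed
    then show ?thesis using Suc.IH \<open>j < m\<close> by (simp add: poly_eq_iff)
  qed simp
qed simp

text \<open>Compatibility of the bases says that they are the initial segments of one sequence.\<close>

definition limit_basis :: "(nat \<Rightarrow> nat \<Rightarrow> nat \<Rightarrow> 'a poly) \<Rightarrow> nat \<Rightarrow> nat \<Rightarrow> 'a poly" where
  "limit_basis \<bb> i j = \<bb> (Suc j) i j"

definition coord :: "(nat \<Rightarrow> nat \<Rightarrow> nat \<Rightarrow> 'a::field poly) \<Rightarrow> nat \<Rightarrow> nat \<Rightarrow> nat \<Rightarrow> 'a poly \<Rightarrow> 'a" where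
  "coord \<bb> m i j p = poly_vs.representation (\<bb> m i ` {..<m}) p (\<bb> m i j)"

lemma theta_eq_block_vec: "\<theta> s \<bb> m k = block_vec s m (\<lambda>i j. coord \<bb> m i j (k i))"
  by (simp add: \<theta>_def block_vec_def coord_def Let_def)

context
  fixes s :: nat and \<bb> :: "nat \<Rightarrow> nat \<Rightarrow> nat \<Rightarrow> 'a::field poly"
  assumes compat: "compatible_bases s \<bb>"
begin

lemma limit_basis_eq:
  assumes "i < s" "j < m"
  shows "\<bb> m i j = limit_basis \<bb> i j"
  using compatible_basis_stable[OF compat assms] by (simp add: limit_basis_def)

lemma degree_limit_basis:
  assumes "i < s"
  shows "degree (limit_basis \<bb> i j) \<le> j"
  using compatible_basis_mem_R[OF compat assms, of j "Suc j"] by (simp add: limit_basis_def R_def)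

lemma basis_facts:
  assumes "i < s" "m \<ge> 1"
  shows "inj_on (\<bb> m i) {..<m}" "poly_vs.independent (\<bb> m i ` {..<m})" "poly_vs.span (\<bb> m i ` {..<m}) = R m"
  using compat assms by (auto simp: compatible_bases_def ordered_basis_def)

lemma sum_coord:
  assumes "i < s" "m \<ge> 1" "p \<in> R m"
  shows "(\<Sum>j<m. smult (coord \<bb> m i j p) (limit_basis \<bb> i j)) = p"
proof -
  note b = basis_facts[OF assms(1,2)]
  have "p = (\<Sum>v\<in>\<bb> m i ` {..<m}. smult (poly_vs.representation (\<bb> m i ` {..<m}) p v) v)"
    using b assms(3) by (intro poly_vs.sum_representation_eq[symmetric]) auto
  also have "\<dots> = (\<Sum>j<m. smult (coord \<bb> m i j p) (\<bb> m i j))"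
    using b(1) by (simp add: sum.reindex coord_def)
  also have "\<dots> = (\<Sum>j<m. smult (coord \<bb> m i j p) (limit_basis \<bb> i j))"
    using assms(1) by (intro sum.cong) (auto simp: limit_basis_eq)
  finally show ?thesis by simp
qed

lemma coord_limit_basis:
  assumes "i < s" "j < m" "j' < m"
  shows "coord \<bb> m i j' (limit_basis \<bb> i j) = (if j' = j then 1 else 0)"
proof -
  have "m \<ge> 1" using assms by simp
  note b = basis_facts[OF assms(1) this]
  have "\<bb> m i j \<in> \<bb> m i ` {..<m}" using assms by simp
  from poly_vs.representation_basis[OF b(2) this]
  have "coord \<bb> m i j' (\<bb> m i j) = (if \<bb> m i j' = \<bb> m i j then 1 else 0)"
    by (simp add: coord_def)
  also have "\<bb> m i j' = \<bb> m i j \<longleftrightarrow> j' = j"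
    using b(1) assms by (auto dest: inj_onD)
  finally show ?thesis using assms by (simp add: limit_basis_eq)
qed

lemma coord_sum_smult:
  assumes "i < s" "m \<ge> 1" "\<And>a. a \<in> A \<Longrightarrow> f a \<in> R m"
  shows "coord \<bb> m i j (\<Sum>a\<in>A. smult (c a) (f a)) = (\<Sum>a\<in>A. c a * coord \<bb> m i j (f a))"
proof -
  note b = basis_facts[OF assms(1,2)]
  have span: "smult (c a) (f a) \<in> poly_vs.span (\<bb> m i ` {..<m})" if "a \<in> A" for a
    using assms(3)[OF that] b(3) by (intro poly_vs.span_scale) simp
  have "coord \<bb> m i j (\<Sum>a\<in>A. smult (c a) (f a)) = (\<Sum>a\<in>A. coord \<bb> m i j (smult (c a) (f a)))"
    unfolding coord_def by (subst poly_vs.representation_sum[OF b(2)]) (use span in auto)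
  also have "\<dots> = (\<Sum>a\<in>A. c a * coord \<bb> m i j (f a))"
    unfolding coord_def using b assms(3) by (intro sum.cong) (auto simp: poly_vs.representation_scale)
  finally show ?thesis .
qed

text \<open>The first \<open>d\<close> members form a basis of \<open>R d\<close>, so coordinates at
  level \<open>d\<close> read off the coefficients.\<close>

lemma limit_basis_independent:
  assumes "i < s" "(\<Sum>j<d. smult (c j) (limit_basis \<bb> i j)) = 0" "j < d"
  shows "c j = 0"
proof -
  have mem: "limit_basis \<bb> i j \<in> R d" if "j < d" for j
    using degree_limit_basis[OF assms(1), of j] that by (simp add: R_def)
  have "d \<ge> 1" using assms by simp
  have "0 = coord \<bb> d i j (\<Sum>j<d. smult (c j) (limit_basis \<bb> i j))"
    unfolding assms(2) coord_def by (simp add: poly_vs.representation_zero)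
  also have "\<dots> = (\<Sum>j'<d. c j' * coord \<bb> d i j (limit_basis \<bb> i j'))"
    using mem by (intro coord_sum_smult assms(1) \<open>d \<ge> 1\<close>) auto
  also have "\<dots> = (\<Sum>j'<d. if j' = j then c j' else 0)"
    using assms by (intro sum.cong) (auto simp: coord_limit_basis)
  also have "\<dots> = c j" using assms(3) by simp
  finally show ?thesis by simp
qed

end

section \<open>Explicit matrices for a given tuple of power series\<close>

text \<open>In coordinates, the columns \<open>r\<close> of all these matrices together represent
  the functional that sends \<open>k\<close> to the coefficient of \<open>x ^ r\<close> in
  \<open>\<Sum>i<s. \<alpha> i * k i\<close>. As the bases are nested, one infinite matrix serves
  every \<open>m\<close>.\<close>

definition hyperplane_matrix ::
  "(nat \<Rightarrow> nat \<Rightarrow> nat \<Rightarrow> 'a::field poly) \<Rightarrow> (nat \<Rightarrow> 'a fps) \<Rightarrow> nat \<Rightarrow> nat \<Rightarrow> nat \<Rightarrow> 'a" where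
  "hyperplane_matrix \<bb> \<alpha> i j r = fps_nth (\<alpha> i * fps_of_poly (limit_basis \<bb> i j)) r"

lemma fps_nth_smult_sum:
  fixes f :: "'a::field fps"
  shows "fps_nth (f * fps_of_poly (\<Sum>j\<in>A. smult (c j) (p j))) r = (\<Sum>j\<in>A. c j * fps_nth (f * fps_of_poly (p j)) r)"
proof -
  have scale: "f * fps_of_poly (smult a g) = fps_const a * (f * fps_of_poly g)" for a g
    unfolding fps_of_poly_smult by (rule mult.left_commute)
  show ?thesis
    by (simp only: fps_of_poly_sum sum_distrib_left fps_sum_nth scale fps_mult_left_const_nth)
qed

lemma coeff_fps_reduce: "coeff (fps_reduce m \<alpha>) n = (if n < m then fps_nth \<alpha> n else 0)"
  by (simp add: fps_reduce_def coeff_Poly_eq nth_default_def)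

text \<open>Coefficients of a product below \<open>m\<close> involve only coefficients of the
  factors below \<open>m\<close>, so reducing \<open>\<alpha> i\<close> modulo \<open>x ^ m\<close>
  does not affect the condition.\<close>

lemma mem_N'_iff:
  "k \<in> N' s m \<alpha> \<longleftrightarrow> (\<forall>i<s. k i \<in> R m) \<and> annihilates s m \<alpha> (\<lambda>i. fps_of_poly (k i))"
proof -
  have "coeff (fps_reduce m (\<alpha> i) * k i) n = fps_nth (\<alpha> i * fps_of_poly (k i)) n" if "n < m" for i n
    using that by (auto simp: coeff_mult fps_mult_nth coeff_fps_reduce atLeast0AtMost intro!: sum.cong)
  then show ?thesis
    by (simp add: N'_def annihilates_def cong_0_iff monom_1_dvd_iff' coeff_sum fps_sum_nth)
qed

text \<open>Expanding each \<open>k i\<close> in the basis turns the inner product into the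
  coefficient of \<open>x ^ r\<close> in the relation, which vanishes for
  \<open>r < m\<close>.\<close>

lemma hyperplane_matrix_row_orthogonal:
  assumes "compatible_bases s \<bb>" "m \<ge> 1" "r < m" "w \<in> N s \<bb> m \<alpha>"
  shows "block_vec s m (\<lambda>i j. hyperplane_matrix \<bb> \<alpha> i j r) \<bullet> w = 0"
proof -
  obtain k where k: "k \<in> N' s m \<alpha>" "w = \<theta> s \<bb> m k" using assms(4) by (auto simp: N_def)
  have "block_vec s m (\<lambda>i j. hyperplane_matrix \<bb> \<alpha> i j r) \<bullet> w
    = (\<Sum>i<s. \<Sum>j<m. hyperplane_matrix \<bb> \<alpha> i j r * coord \<bb> m i j (k i))"
    using assms(2) by (simp add: k(2) theta_eq_block_vec block_vec_scalar_prod)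
  also have "\<dots> = (\<Sum>i<s. fps_nth (\<alpha> i * fps_of_poly (k i)) r)"
  proof (rule sum.cong[OF refl])
    fix i assume "i \<in> {..<s}"
    then have "k i = (\<Sum>j<m. smult (coord \<bb> m i j (k i)) (limit_basis \<bb> i j))"
      using sum_coord[OF assms(1) _ assms(2)] k(1) by (simp add: mem_N'_iff)
    then have "fps_nth (\<alpha> i * fps_of_poly (k i)) r
      = fps_nth (\<alpha> i * fps_of_poly (\<Sum>j<m. smult (coord \<bb> m i j (k i)) (limit_basis \<bb> i j))) r"
      by simp
    also have "\<dots> = (\<Sum>j<m. coord \<bb> m i j (k i) * hyperplane_matrix \<bb> \<alpha> i j r)"
      unfolding fps_nth_smult_sum hyperplane_matrix_def ..
    finally show "(\<Sum>j<m. hyperplane_matrix \<bb> \<alpha> i j r * coord \<bb> m i j (k i)) = fps_nth (\<alpha> i * fps_of_poly (k i)) r"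
      by (simp add: mult.commute)
  qed
  also have "\<dots> = 0"
    using k(1) assms(3) by (simp add: mem_N'_iff annihilates_def fps_sum_nth)
  finally show ?thesis .
qed

lemma hyperplane_matrix_row_mem_complement:
  assumes "compatible_bases s \<bb>" "m \<ge> 1" "r < m"
  shows "block_vec s m (\<lambda>i j. hyperplane_matrix \<bb> \<alpha> i j r) \<in> vec_module.orthogonal_complement (s * m) (N s \<bb> m \<alpha>)"
  using hyperplane_matrix_row_orthogonal[OF assms]
  by (simp add: vec_module.orthogonal_complement_def)

lemma complement_subset_row_space:
  fixes \<alpha> :: "nat \<Rightarrow> 'a::field fps"
  assumes compat: "compatible_bases s \<bb>" and "m \<ge> 1" "s \<ge> 1" "\<alpha> 0 = 1"
    and v: "v \<in> vec_module.orthogonal_complement (s * m) (N s \<bb> m \<alpha>)"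
  shows "v \<in> vec_space.row_space (s * m) (juxtaposed s (hyperplane_matrix \<bb> \<alpha>) m)"
proof -
  have "v \<in> carrier_vec (s * m)" and orth: "\<And>k. k \<in> N' s m \<alpha> \<Longrightarrow> v \<bullet> \<theta> s \<bb> m k = 0"
    using v by (auto simp: vec_module.orthogonal_complement_def N_def)
  then obtain f where f: "v = block_vec s m f" by (elim carrier_vec_eq_block_vec)
  \<comment> \<open>Since \<open>\<alpha>\<^sub>0 = 1\<close>, relations \<open>k\<close> with \<open>k\<^sub>0\<close> prescribed by a single other component show that \<open>v\<close> is
    determined by its block \<open>0\<close>, read as a linear functional \<open>\<Lambda>\<close> on \<open>R m\<close>.\<close>
  define \<Lambda> where "\<Lambda> p = (\<Sum>j<m. f 0 j * coord \<bb> m 0 j p)" for p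
  \<comment> \<open>The values of \<open>\<Lambda>\<close> at the monomials are the coefficients
    that express \<open>v\<close> through the rows of the juxtaposed matrix.\<close>
  define u where "u r = \<Lambda> (monom 1 r)" for r
  have \<Lambda>: "\<Lambda> p = (\<Sum>r<m. u r * coeff p r)" if "p \<in> R m" for p
  proof -
    have p: "p = (\<Sum>r<m. smult (coeff p r) (monom 1 r))"
    proof (rule poly_eqI)
      fix n
      show "coeff p n = coeff (\<Sum>r<m. smult (coeff p r) (monom 1 r)) n"
        using that by (auto simp: coeff_sum R_def if_distrib[of "\<lambda>x. _ * x"] coeff_eq_0 cong: if_cong)
    qed
    have "coord \<bb> m 0 j p = (\<Sum>r<m. coeff p r * coord \<bb> m 0 j (monom 1 r))" for j
    proof -
      have "coord \<bb> m 0 j (\<Sum>r<m. smult (coeff p r) (monom 1 r)) = (\<Sum>r<m. coeff p r * coord \<bb> m 0 j (monom 1 r))"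
        using assms by (intro coord_sum_smult[OF compat]) (auto simp: R_def degree_monom_eq)
      then show ?thesis using p by simp
    qed
    then have "\<Lambda> p = (\<Sum>j<m. \<Sum>r<m. f 0 j * (coeff p r * coord \<bb> m 0 j (monom 1 r)))"
      by (simp add: \<Lambda>_def sum_distrib_left)
    also have "\<dots> = (\<Sum>r<m. \<Sum>j<m. f 0 j * (coeff p r * coord \<bb> m 0 j (monom 1 r)))"
      by (rule sum.swap)
    also have "\<dots> = (\<Sum>r<m. u r * coeff p r)"
      unfolding u_def \<Lambda>_def sum_distrib_right by (simp only: mult_ac)
    finally show ?thesis .
  qed
  have entry: "f i j = (\<Sum>r<m. u r * hyperplane_matrix \<bb> \<alpha> i j r)" if ij: "i < s" "j < m" for i j
  proof (cases "i = 0")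
    case True
    have "limit_basis \<bb> 0 j \<in> R m"
      using degree_limit_basis[OF compat, of 0 j] ij True by (simp add: R_def)
    then have "(\<Sum>r<m. u r * coeff (limit_basis \<bb> 0 j) r) = \<Lambda> (limit_basis \<bb> 0 j)" by (simp add: \<Lambda>)
    also have "\<dots> = (\<Sum>j'<m. if j' = j then f 0 j' else 0)"
      unfolding \<Lambda>_def using ij True by (intro sum.cong) (auto simp: coord_limit_basis[OF compat])
    also have "\<dots> = f 0 j" using ij by simp
    finally show ?thesis using True \<open>\<alpha> 0 = 1\<close> by (simp add: hyperplane_matrix_def)
  next
    case False
    let ?g = "\<alpha> i * fps_of_poly (limit_basis \<bb> i j)"
    define h where "h = fps_reduce m ?g"
    \<comment> \<open>Since \<open>\<alpha> 0 = 1\<close>, the entry \<open>- h\<close> cancels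
      \<open>?g\<close> modulo \<open>x ^ m\<close>. Orthogonality of \<open>v\<close> to this
      relation yields the entry \<open>f i j\<close>.\<close>
    define k where "k = (\<lambda>l. 0)(0 := - h, i := limit_basis \<bb> i j)"
    have h: "h \<in> R m"
    proof -
      have "degree h \<le> m - 1" by (rule degree_le) (auto simp: h_def coeff_fps_reduce)
      then show ?thesis using \<open>m \<ge> 1\<close> by (simp add: R_def)
    qed
    have "limit_basis \<bb> i j \<in> R m"
      using degree_limit_basis[OF compat, of i j] ij by (simp add: R_def)
    with h have kR: "k l \<in> R m" for l using \<open>m \<ge> 1\<close> by (auto simp: k_def R_def)
    have split: "(\<Sum>l<s. F l) = F 0 + F i" if "\<And>l. l < s \<Longrightarrow> l \<noteq> 0 \<Longrightarrow> l \<noteq> i \<Longrightarrow> F l = 0"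
      for F :: "nat \<Rightarrow> 'b::comm_monoid_add"
    proof -
      have "(\<Sum>l<s. F l) = (\<Sum>l\<in>{0, i}. F l)"
        using that ij by (intro sum.mono_neutral_right) auto
      then show ?thesis using False by simp
    qed
    have "(\<Sum>l<s. \<alpha> l * fps_of_poly (k l)) = ?g - fps_of_poly h"
      using False by (subst split) (auto simp: k_def \<open>\<alpha> 0 = 1\<close> fps_of_poly_uminus)
    then have "annihilates s m \<alpha> (\<lambda>l. fps_of_poly (k l))"
      by (simp add: annihilates_def h_def coeff_fps_reduce)
    with kR have "k \<in> N' s m \<alpha>" by (simp add: mem_N'_iff)
    from orth[OF this] have "0 = (\<Sum>l<s. \<Sum>j'<m. f l j' * coord \<bb> m l j' (k l))"
      using \<open>m \<ge> 1\<close> by (simp add: f theta_eq_block_vec block_vec_scalar_prod)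
    also have "\<dots> = (\<Sum>j'<m. f 0 j' * coord \<bb> m 0 j' (k 0)) + (\<Sum>j'<m. f i j' * coord \<bb> m i j' (k i))"
      by (rule split) (simp add: k_def coord_def poly_vs.representation_zero)
    also have "(\<Sum>j'<m. f 0 j' * coord \<bb> m 0 j' (k 0)) = \<Lambda> (k 0)" by (simp add: \<Lambda>_def)
    also have "\<dots> = - (\<Sum>r<m. u r * coeff h r)"
      using \<Lambda>[OF kR[of 0]] False by (simp add: k_def sum_negf)
    also have "(\<Sum>r<m. u r * coeff h r) = (\<Sum>r<m. u r * hyperplane_matrix \<bb> \<alpha> i j r)"
      by (rule sum.cong) (auto simp: h_def coeff_fps_reduce hyperplane_matrix_def)
    also have "(\<Sum>j'<m. f i j' * coord \<bb> m i j' (k i)) = (\<Sum>j'<m. if j' = j then f i j' else 0)"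
      using ij by (intro sum.cong) (auto simp: k_def coord_limit_basis[OF compat])
    also have "\<dots> = f i j" using ij by simp
    finally show ?thesis by (simp add: add_eq_0_iff)
  qed
  have "v = block_vec s m (\<lambda>i j. \<Sum>r<m. u r * hyperplane_matrix \<bb> \<alpha> i j r)"
    unfolding f by (rule block_vec_eqI) (rule entry)
  then show ?thesis unfolding row_space_juxtaposed by blast
qed

text \<open>One inclusion extends the orthogonality of the rows to their linear combinations; the
  other is \<open>complement_subset_row_space\<close>.\<close>

lemma hyperplane_matrices_hyperplane_matrix:
  assumes compat: "compatible_bases s \<bb>" and "s \<ge> 1" "\<alpha> 0 = 1"
  shows "hyperplane_matrices s \<bb> \<alpha> (hyperplane_matrix \<bb> \<alpha>)"
  unfolding hyperplane_matrices_def
proof (intro allI impI equalityI subsetI)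
  fix m :: nat and v assume "m \<ge> 1"
  {
    assume "v \<in> vec_module.orthogonal_complement (s * m) (N s \<bb> m \<alpha>)"
    then show "v \<in> vec_space.row_space (s * m) (juxtaposed s (hyperplane_matrix \<bb> \<alpha>) m)"
      using assms \<open>m \<ge> 1\<close> by (intro complement_subset_row_space)
  next
    assume "v \<in> vec_space.row_space (s * m) (juxtaposed s (hyperplane_matrix \<bb> \<alpha>) m)"
    then obtain u where v: "v = block_vec s m (\<lambda>i j. \<Sum>r<m. u r * hyperplane_matrix \<bb> \<alpha> i j r)"
      unfolding row_space_juxtaposed by blast
    have "v \<bullet> w = 0" if w: "w \<in> N s \<bb> m \<alpha>" for w
    proof -
      obtain g where g: "w = block_vec s m g"
        using w by (auto simp: N_def theta_eq_block_vec)
      have "v \<bullet> w = (\<Sum>i<s. \<Sum>j<m. \<Sum>r<m. u r * (hyperplane_matrix \<bb> \<alpha> i j r * g i j))"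
        using \<open>m \<ge> 1\<close> by (simp add: v g block_vec_scalar_prod sum_distrib_right mult.assoc)
      also have "\<dots> = (\<Sum>i<s. \<Sum>r<m. \<Sum>j<m. u r * (hyperplane_matrix \<bb> \<alpha> i j r * g i j))"
        by (intro sum.cong refl sum.swap)
      also have "\<dots> = (\<Sum>r<m. \<Sum>i<s. \<Sum>j<m. u r * (hyperplane_matrix \<bb> \<alpha> i j r * g i j))"
        by (rule sum.swap)
      also have "\<dots> = (\<Sum>r<m. u r * (block_vec s m (\<lambda>i j. hyperplane_matrix \<bb> \<alpha> i j r) \<bullet> w))"
        using \<open>m \<ge> 1\<close> by (simp add: g block_vec_scalar_prod sum_distrib_left)
      also have "\<dots> = 0"
        using hyperplane_matrix_row_orthogonal[OF compat \<open>m \<ge> 1\<close> _ w] by simp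
      finally show ?thesis .
    qed
    then show "v \<in> vec_module.orthogonal_complement (s * m) (N s \<bb> m \<alpha>)"
      by (simp add: vec_module.orthogonal_complement_def v)
  }
qed

text \<open>\<open>C\<close> is any family with the hyperplane property. Its row space contains the
  explicit rows, so a dependence \<open>c\<close> among rows of the \<open>C i\<close> is orthogonal
  to those too, and the polynomials with basis coefficients \<open>c\<close> satisfy the relation
  modulo \<open>x ^ m\<close>. Their degrees make it short, so they vanish, and so does
  \<open>c\<close>.\<close>

lemma independent_rows_of_no_short_relation:
  fixes C :: "nat \<Rightarrow> nat \<Rightarrow> nat \<Rightarrow> 'a::field"
  assumes compat: "compatible_bases s \<bb>" and C: "hyperplane_matrices s \<bb> \<alpha> C" and "m \<ge> 1" "M \<le> m"
    and good: "\<not> short_relation s m M \<alpha>" and d: "(\<Sum>i<s. d i) = M"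
    and c: "\<And>r. r < m \<Longrightarrow> (\<Sum>i<s. \<Sum>j<d i. c i j * C i j r) = 0"
    and ij: "i < s" "j < d i"
  shows "c i j = 0"
proof -
  have d_le: "d l \<le> m" if "l < s" for l
  proof -
    have "d l \<le> (\<Sum>i<s. d i)" using that by (intro member_le_sum) auto
    then show ?thesis using d \<open>M \<le> m\<close> by simp
  qed
  \<comment> \<open>Padding with zeros up to \<open>m\<close> lets the dependence be paired with
    vectors of length \<open>s * m\<close>.\<close>
  define c' where "c' l n = (if n < d l then c l n else 0)" for l n
  have pad: "(\<Sum>n<m. c' l n * F n) = (\<Sum>n<d l. c l n * F n)" if "l < s" for l and F :: "nat \<Rightarrow> 'a"
  proof -
    have "(\<Sum>n<m. c' l n * F n) = (\<Sum>n<d l. c' l n * F n)"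
      using d_le[OF that] by (intro sum.mono_neutral_right) (auto simp: c'_def)
    then show ?thesis by (simp add: c'_def)
  qed
  define k where "k l = (\<Sum>n<d l. smult (c l n) (limit_basis \<bb> l n))" for l
  have ann: "annihilates s m \<alpha> (\<lambda>l. fps_of_poly (k l))"
    unfolding annihilates_def
  proof (intro allI impI)
    fix r assume "r < m"
    have "block_vec s m (\<lambda>i j. hyperplane_matrix \<bb> \<alpha> i j r) \<in> vec_space.row_space (s * m) (juxtaposed s C m)"
      using C hyperplane_matrix_row_mem_complement[OF compat \<open>m \<ge> 1\<close> \<open>r < m\<close>] \<open>m \<ge> 1\<close>
      by (simp add: hyperplane_matrices_def)
    then obtain u where u: "block_vec s m (\<lambda>i j. hyperplane_matrix \<bb> \<alpha> i j r)
        = block_vec s m (\<lambda>i j. \<Sum>r<m. u r * C i j r)"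
      unfolding row_space_juxtaposed by blast
    have "fps_nth (\<Sum>l<s. \<alpha> l * fps_of_poly (k l)) r = (\<Sum>l<s. \<Sum>n<d l. c l n * hyperplane_matrix \<bb> \<alpha> l n r)"
      by (simp add: fps_sum_nth k_def fps_nth_smult_sum hyperplane_matrix_def)
    also have "\<dots> = block_vec s m c' \<bullet> block_vec s m (\<lambda>i j. hyperplane_matrix \<bb> \<alpha> i j r)"
      using \<open>m \<ge> 1\<close> by (simp add: block_vec_scalar_prod pad)
    also have "\<dots> = (\<Sum>l<s. \<Sum>n<m. \<Sum>r<m. u r * (c' l n * C l n r))"
      unfolding u using \<open>m \<ge> 1\<close> by (simp add: block_vec_scalar_prod sum_distrib_left mult.left_commute)
    also have "\<dots> = (\<Sum>l<s. \<Sum>r<m. \<Sum>n<m. u r * (c' l n * C l n r))"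
      by (intro sum.cong refl sum.swap)
    also have "\<dots> = (\<Sum>r<m. \<Sum>l<s. \<Sum>n<m. u r * (c' l n * C l n r))"
      by (rule sum.swap)
    also have "\<dots> = (\<Sum>r<m. u r * (\<Sum>l<s. \<Sum>n<d l. c l n * C l n r))"
      unfolding sum_distrib_left[symmetric] by (intro sum.cong refl arg_cong2[of _ _ _ _ times] pad) simp
    also have "\<dots> = 0" by (simp add: c)
    finally show "fps_nth (\<Sum>l<s. \<alpha> l * fps_of_poly (k l)) r = 0" .
  qed
  have box: "fps_of_poly (k l) \<in> fps_box 0 (d l)" if "l < s" for l
  proof -
    have "coeff (k l) n = 0" if "n \<ge> d l" for n
    proof -
      have "coeff (limit_basis \<bb> l n') n = 0" if "n' < d l" for n'
        using degree_limit_basis[OF compat \<open>l < s\<close>, of n'] that \<open>n \<ge> d l\<close> by (intro coeff_eq_0) simp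
      then show ?thesis by (simp add: k_def coeff_sum)
    qed
    then show ?thesis unfolding fps_box_def by (auto simp: not_le[symmetric])
  qed
  have "fps_of_poly (k i) = fps_of_poly 0"
  proof (rule ccontr)
    assume "fps_of_poly (k i) \<noteq> fps_of_poly 0"
    then have "\<exists>l<s. fps_of_poly (k l) \<noteq> 0" using ij(1) by auto
    with d box ann have "short_relation s m M \<alpha>"
      unfolding short_relation_def by (intro exI[of _ d] exI[of _ "\<lambda>l. fps_of_poly (k l)"] conjI) auto
    with good show False ..
  qed
  then have "k i = 0" by (simp only: fps_of_poly_eq_iff)
  then show ?thesis
    using limit_basis_independent[OF compat ij(1) _ ij(2), of "c i"] by (simp add: k_def)
qed

section \<open>The quality parameter\<close>

text \<open>The truncated inverse series is an inverse modulo \<open>x ^ m\<close>, so a common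
  divisor with \<open>x ^ m\<close> divides 1.\<close>

lemma mem_Y_of_unit:
  fixes \<alpha> :: "'a::field fps"
  assumes "fps_nth \<alpha> 0 \<noteq> 0"
  shows "\<alpha> \<in> Y"
  unfolding Y_def
proof (intro CollectI allI impI)
  fix m :: nat assume "m \<ge> 1"
  let ?p = "fps_reduce m \<alpha>" and ?g = "fps_reduce m (inverse \<alpha>)"
  have "coeff (?p * ?g) n = fps_nth (\<alpha> * inverse \<alpha>) n" if "n < m" for n
    using that by (auto simp: coeff_mult fps_mult_nth coeff_fps_reduce atLeast0AtMost intro!: sum.cong)
  moreover have "\<alpha> * inverse \<alpha> = 1" using assms by (simp add: inverse_mult_eq_1')
  ultimately have "coeff (?p * ?g - 1) n = 0" if "n < m" for n using that by simp
  then have dvd: "monom 1 m dvd ?p * ?g - 1" by (simp add: monom_1_dvd_iff')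
  show "coprime ?p (monom 1 m)"
  proof (rule coprimeI)
    fix c assume "c dvd ?p" "c dvd monom 1 m"
    then have "c dvd ?p * ?g - (?p * ?g - 1)" using dvd by (meson dvd_diff dvd_mult2 dvd_trans)
    then show "is_unit c" by simp
  qed
qed

text \<open>\<open>t m\<close> is the desired bound rounded down and capped at \<open>m\<close>.
  Where the cap is attained, \<open>m - t m = 0\<close> and the level drops out of the sum;
  elsewhere the term is at most a small multiple of \<open>\<beta> m\<close>.\<close>

lemma quality_parameter_exists:
  fixes \<beta> :: "nat \<Rightarrow> real" and q :: nat
  assumes "q \<ge> 2" and pos: "\<And>m. m \<ge> 1 \<Longrightarrow> \<beta> m > 0" and summ: "summable (\<lambda>m. \<beta> (Suc m))"
  shows "\<exists>(L::int) t. (\<forall>m. t m \<le> m) \<and>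
    (\<forall>m\<ge>1. real (t m) \<le> log (real q) (real m ^ p / \<beta> m) + real_of_int L) \<and>
    (\<forall>n. (\<Sum>m | m \<in> {1..n} \<and> m - t m > 0.
        4 * real (m - t m + 1) ^ p * real q ^ (m - t m) / real q ^ m) < 1)"
proof -
  define S where "S = (\<Sum>m. \<beta> (Suc m))"
  have partial: "(\<Sum>m\<in>{1..n}. \<beta> m) \<le> S" for n
  proof -
    have "(\<Sum>m\<in>{1..n}. \<beta> m) = (\<Sum>m<n. \<beta> (Suc m))"
      by (rule sum.reindex_bij_witness[of _ Suc "\<lambda>m. m - 1"]) auto
    also have "\<dots> \<le> S"
      unfolding S_def using pos by (intro sum_le_suminf summ) (auto intro: less_imp_le)
    finally show ?thesis .
  qed
  have \<beta>_le: "\<beta> m \<le> S" if "m \<ge> 1" for m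
  proof -
    have "\<beta> m \<le> (\<Sum>m\<in>{1..m}. \<beta> m)"
      using that pos by (intro member_le_sum) (auto intro: less_imp_le)
    then show ?thesis using partial[of m] by simp
  qed
  have "S > 0" using \<beta>_le[of 1] pos[of 1] by simp
  define b where "b = real q"
  have b: "b \<ge> 2" using assms(1) by (simp add: b_def)
  \<comment> \<open>The factor 4 comes from the counting bound, \<open>2 ^ p\<close> from
    \<open>m - t m + 1 \<le> 2 * m\<close>, and \<open>b\<close> from rounding down.\<close>
  define A where "A = 4 * 2 ^ p * b"
  have "A \<ge> 1"
  proof -
    have "1 * 1 \<le> (4 * 2 ^ p) * b" using b by (intro mult_mono) (auto simp: mult_ge1_I)
    then show ?thesis by (simp add: A_def)
  qed
  \<comment> \<open>Adding 1 to the floor gives the strict inequality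
    \<open>A * S < b powr L\<close>, which keeps the total below 1. With \<open>A \<ge> 1\<close> it
    also gives \<open>S \<le> b powr L\<close>, which makes the bound \<open>X m\<close>
    nonnegative, so that its floor is a natural number.\<close>
  define L where "L = \<lfloor>log b (A * S)\<rfloor> + 1"
  have "log b (A * S) < real_of_int L" unfolding L_def by linarith
  then have AS: "A * S < b powr L"
    using b \<open>A \<ge> 1\<close> \<open>S > 0\<close> by (subst (asm) log_less_iff) auto
  have "1 * S \<le> A * S" using \<open>A \<ge> 1\<close> \<open>S > 0\<close> by (intro mult_right_mono) auto
  with AS have SL: "S \<le> b powr L" by simp
  define X where "X m = log b (real m ^ p / \<beta> m) + real_of_int L" for m
  have X_powr: "b powr X m = real m ^ p / \<beta> m * b powr L" if "m \<ge> 1" for m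
    using that b pos[OF that] by (simp add: X_def powr_add)
  have X_nonneg: "X m \<ge> 0" if "m \<ge> 1" for m
  proof -
    have "1 \<le> real m ^ p" using that by simp
    moreover have "\<beta> m \<le> b powr L" using \<beta>_le[OF that] SL by simp
    ultimately have "1 * \<beta> m \<le> real m ^ p * b powr L"
      using pos[OF that] by (intro mult_mono) auto
    then have "b powr X m \<ge> 1" using X_powr[OF that] pos[OF that] by (simp add: le_divide_eq)
    moreover have "b powr X m < b powr 0" if "X m < 0" using b that by (intro powr_less_mono) auto
    ultimately show ?thesis using b by force
  qed
  define t where "t m = min m (nat \<lfloor>X m\<rfloor>)" for m
  have t_le: "t m \<le> m" for m by (simp add: t_def)
  have t_X: "real (t m) \<le> X m" if "m \<ge> 1" for m
  proof -
    have "real (t m) \<le> real (nat \<lfloor>X m\<rfloor>)" by (simp add: t_def)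
    also have "\<dots> \<le> X m" using X_nonneg[OF that] by simp
    finally show ?thesis .
  qed
  define \<kappa> where "\<kappa> = A / b powr L"
  have term_le: "4 * real (m - t m + 1) ^ p * b ^ (m - t m) / b ^ m \<le> \<kappa> * \<beta> m"
    if m: "m \<ge> 1" "m - t m > 0" for m
  proof -
    \<comment> \<open>A positive difference means that the cap at \<open>m\<close> is inactive, so
      \<open>t m\<close> is within 1 of \<open>X m\<close>.\<close>
    have "t m = nat \<lfloor>X m\<rfloor>" using m(2) unfolding t_def by linarith
    then have "X m - 1 \<le> real (t m)" using X_nonneg[OF m(1)] by linarith
    then have "b powr (X m - 1) \<le> b powr real (t m)" using b by (intro powr_mono) auto
    then have "real m ^ p / \<beta> m * b powr L / b \<le> b ^ t m"
      using X_powr[OF m(1)] b by (simp add: powr_diff powr_realpow)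
    then have low: "real m ^ p * b powr L \<le> b ^ t m * (b * \<beta> m)"
      using b pos[OF m(1)] by (simp add: field_simps)
    have "b ^ m = b ^ (m - t m) * b ^ t m" using t_le[of m] by (simp flip: power_add)
    then have "4 * real (m - t m + 1) ^ p * b ^ (m - t m) / b ^ m = 4 * real (m - t m + 1) ^ p / b ^ t m"
      using b by simp
    also have "\<dots> \<le> 4 * (2 * real m) ^ p / b ^ t m"
    proof -
      have "real (m - t m + 1) \<le> 2 * real m" using m(1) by linarith
      then show ?thesis using b by (intro divide_right_mono mult_left_mono power_mono) auto
    qed
    also have "\<dots> \<le> \<kappa> * \<beta> m"
    proof -
      have "4 * 2 ^ p * (real m ^ p * b powr L) \<le> 4 * 2 ^ p * (b ^ t m * (b * \<beta> m))"
        using low by (intro mult_left_mono) auto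
      then show ?thesis using b by (simp add: \<kappa>_def A_def field_simps power_mult_distrib)
    qed
    finally show ?thesis .
  qed
  have "(\<Sum>m | m \<in> {1..n} \<and> m - t m > 0. 4 * real (m - t m + 1) ^ p * b ^ (m - t m) / b ^ m) < 1" for n
  proof -
    have "\<kappa> \<ge> 0" using \<open>A \<ge> 1\<close> by (simp add: \<kappa>_def)
    have "(\<Sum>m | m \<in> {1..n} \<and> m - t m > 0. 4 * real (m - t m + 1) ^ p * b ^ (m - t m) / b ^ m)
        \<le> (\<Sum>m | m \<in> {1..n} \<and> m - t m > 0. \<kappa> * \<beta> m)"
      using term_le by (intro sum_mono) auto
    also have "\<dots> \<le> (\<Sum>m\<in>{1..n}. \<kappa> * \<beta> m)"
      using \<open>\<kappa> \<ge> 0\<close> pos by (intro sum_mono2) (auto intro!: mult_nonneg_nonneg intro: less_imp_le)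
    also have "\<dots> = \<kappa> * (\<Sum>m\<in>{1..n}. \<beta> m)" by (simp add: sum_distrib_left)
    also have "\<dots> \<le> \<kappa> * S" using partial \<open>\<kappa> \<ge> 0\<close> by (rule mult_left_mono)
    also have "\<dots> < 1" using AS b by (simp add: \<kappa>_def field_simps)
    finally show ?thesis .
  qed
  then show ?thesis
    using t_le t_X unfolding b_def X_def by (intro exI[of _ L] exI[of _ t]) blast
qed

theorem theorem10:
  fixes s :: nat and \<beta> :: "nat \<Rightarrow> real"
  assumes "s \<ge> 2"
    and "\<And>m. m \<ge> 1 \<Longrightarrow> \<beta> m > 0"
    and "summable (\<lambda>m. \<beta> (Suc m))"
  shows "\<exists>L::int. \<forall>(\<phi> :: nat \<Rightarrow> 'a::{field,finite}) \<bb>.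
    digit_bijection \<phi> \<and> compatible_bases s \<bb> \<longrightarrow>
    (\<exists>\<alpha>\<in>Y_tilde s.
       (\<exists>C. hyperplane_matrices s \<bb> \<alpha> C) \<and>
       (\<forall>C. hyperplane_matrices s \<bb> \<alpha> C \<longrightarrow>
          (\<exists>T. is_TS_sequence CARD('a) T s (digital_sequence \<phi> C) (digital_digit \<phi> C) \<and>
               (\<forall>m\<ge>1. real (T m) \<le>
                  log (real CARD('a)) (real m ^ (s - 1) / \<beta> m) + real_of_int L))))"
proof -
  let ?q = "CARD('a)"
  obtain L :: int and t where t: "\<And>m. t m \<le> m"
    and bound: "\<And>m. m \<ge> 1 \<Longrightarrow> real (t m) \<le> log (real ?q) (real m ^ (s - 1) / \<beta> m) + real_of_int L"
    and less: "\<And>n. (\<Sum>m | m \<in> {1..n} \<and> m - t m > 0.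
        4 * real (m - t m + 1) ^ (s - 1) * real ?q ^ (m - t m) / real ?q ^ m) < 1"
    using quality_parameter_exists[OF card_field_ge_2[where 'a='a] assms(2,3), of "s - 1"] by blast
  \<comment> \<open>The tuple is chosen before \<open>\<phi>\<close> and the bases: short relations
    are stated through degrees alone, so one tuple serves all choices.\<close>
  obtain \<alpha> :: "nat \<Rightarrow> 'a fps" where \<alpha>: "\<alpha> 0 = 1" "\<And>i. i < s \<Longrightarrow> fps_nth (\<alpha> i) 0 \<noteq> 0"
    and good: "\<And>m. m \<ge> 1 \<Longrightarrow> \<not> short_relation s m (m - t m) \<alpha>"
    using exists_good_tuple[OF \<open>s \<ge> 2\<close>, of "\<lambda>m. m - t m", where 'a='a] less by auto
  have "\<alpha> \<in> Y_tilde s" using \<alpha> by (simp add: Y_tilde_def mem_Y_of_unit)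
  moreover have "\<exists>C. hyperplane_matrices s \<bb> \<alpha> C" if "compatible_bases s \<bb>" for \<bb>
    using hyperplane_matrices_hyperplane_matrix[OF that] \<alpha>(1) \<open>s \<ge> 2\<close> by auto
  moreover have "is_TS_sequence ?q t s (digital_sequence \<phi> C) (digital_digit \<phi> C)"
    if \<phi>: "digit_bijection \<phi>" and compat: "compatible_bases s \<bb>" and C: "hyperplane_matrices s \<bb> \<alpha> C"
    for \<phi> \<bb> C
    unfolding is_TS_sequence_def
  proof (intro conjI allI impI)
    show "digital_digit \<phi> C k i j < ?q" for k i j by (rule digital_digit_less[OF \<phi>])
    show "(\<lambda>j. real (digital_digit \<phi> C k i j) / real ?q ^ Suc j) sums digital_sequence \<phi> C k i" for k i
      by (rule digital_sequence_sums[OF \<phi>])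
    show "t m \<le> m" for m by (rule t)
    show "is_net ?q (t m) m s {k * ?q ^ m ..< (k + 1) * ?q ^ m}
        (\<lambda>n i. truncation ?q m (digital_digit \<phi> C n i))" for m k
    proof (rule is_net_of_independent_rows[OF \<phi> t])
      fix d c i j
      assume d: "(\<Sum>i<s. d i) = m - t m" and ij: "i < s" "j < d i"
        and c: "\<And>r. r < m \<Longrightarrow> (\<Sum>i<s. \<Sum>j<d i. c i j * C i j r) = 0"
      \<comment> \<open>The existence of a row forces \<open>d i > 0\<close> and hence
        \<open>m \<ge> 1\<close>, where \<open>good\<close> applies; for \<open>m = 0\<close> there
        are no rows.\<close>
      have "d i \<le> (\<Sum>i<s. d i)" using ij(1) by (intro member_le_sum) auto
      then have "m \<ge> 1" using d ij(2) by simp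
      then show "c i j = 0"
        using independent_rows_of_no_short_relation[OF compat C _ _ good d c ij] by simp
    qed
  qed
  ultimately show ?thesis
    using bound by blast
qed

end
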